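(* Let $n\ge1$ and let $F$ be any finite subgroup of $\mathrm{GL}_n(\mathbb{Z})$. Let $\ell^1(\mathbb{Z}^n/F)$ denote the closed subalgebra of the convolution algebra $\ell^1(\mathbb{Z}^n)$ generated by the elements $$\delta_{F(v)}=\frac{1}{|F|}\sum_{\alpha\in F}\delta_{\alpha(v)},\qquad v\in\mathbb{Z}^n.$$ Then $\ell^1(\mathbb{Z}^n/F)$ is amenable.
   Context: $\delta_v$ denotes the point mass at $v\in\mathbb{Z}^n$. A Banach algebra $\mathcal{A}$ is amenable if every bounded derivation from $\mathcal{A}$ into any dual Banach $\mathcal{A}$-bimodule is inner. *)

theory Defs
  imports "HOL-Analysis.Infinite_Sum" "HOL-Analysis.Cartesian_Space"
    "HOL-Analysis.Operator_Norm" "HOL-Algebra.Group"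
begin


section \<open>Complex normed spaces and algebras\<close>

text \<open>
  The library classes \<^class>\<open>real_normed_vector\<close>, \<^class>\<open>real_normed_algebra\<close> and
  \<^class>\<open>banach\<close> are about real scalars; the next two classes add a complex scalar
  multiplication compatible with the real one and with the norm. A complex Banach space
  is a type of sort \<open>{complex_normed_vector, banach}\<close>, a complex Banach algebra (not
  necessarily unital) a type of sort \<open>{complex_normed_algebra, banach}\<close>.
\<close>

class complex_normed_vector = real_normed_vector +
  fixes scaleC :: "complex \<Rightarrow> 'a \<Rightarrow> 'a"  (infixr \<open>*\<^sub>C\<close> 75)
  assumes scaleC_add_right: "c *\<^sub>C (x + y) = c *\<^sub>C x + c *\<^sub>C y"
    and scaleC_add_left: "(c + d) *\<^sub>C x = c *\<^sub>C x + d *\<^sub>C x"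
    and scaleC_scaleC: "c *\<^sub>C d *\<^sub>C x = (c * d) *\<^sub>C x"
    and scaleC_of_real: "complex_of_real r *\<^sub>C x = r *\<^sub>R x"
    and norm_scaleC: "norm (c *\<^sub>C x) = cmod c * norm x"

class complex_normed_algebra = complex_normed_vector + real_normed_algebra +
  assumes mult_scaleC_left: "(c *\<^sub>C x) * y = c *\<^sub>C (x * y)"
    and mult_scaleC_right: "x * (c *\<^sub>C y) = c *\<^sub>C (x * y)"

definition csubalgebra :: "'a::complex_normed_algebra set \<Rightarrow> bool" where
  "csubalgebra B \<longleftrightarrow> 0 \<in> B \<and> (\<forall>a\<in>B. \<forall>b\<in>B. a + b \<in> B \<and> a * b \<in> B) \<and>
     (\<forall>c. \<forall>a\<in>B. c *\<^sub>C a \<in> B)"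

definition closed_csubalgebra :: "'a::complex_normed_algebra set \<Rightarrow> bool" where
  "closed_csubalgebra B \<longleftrightarrow> csubalgebra B \<and> closed B"

lemma closed_csubalgebra_hull: "closed_csubalgebra (closed_csubalgebra hull S)"
  by (rule hull_in) (auto simp: closed_csubalgebra_def csubalgebra_def)


section \<open>Amenability\<close>

text \<open>
  Below, \<open>A\<close> is a closed subalgebra of a complex Banach algebra, regarded as a Banach
  algebra in its own right: nothing is required of the actions and of the derivations
  outside \<open>A\<close>.
\<close>

definition clinear_on :: "'a::complex_normed_vector set \<Rightarrow> ('a \<Rightarrow> 'x::complex_normed_vector) \<Rightarrow> bool"
  where "clinear_on A f \<longleftrightarrow> (\<forall>a\<in>A. \<forall>b\<in>A. f (a + b) = f a + f b) \<and>
     (\<forall>c. \<forall>a\<in>A. f (c *\<^sub>C a) = c *\<^sub>C f a)"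

text \<open>Here \<open>l a x\<close> is \<open>a \<cdot> x\<close> and \<open>r a x\<close> is \<open>x \<cdot> a\<close>.\<close>

definition banach_bimodule ::
  "'a::complex_normed_algebra set \<Rightarrow> ('a \<Rightarrow> 'x \<Rightarrow> 'x) \<Rightarrow>
     ('a \<Rightarrow> 'x \<Rightarrow> 'x::{complex_normed_vector, banach}) \<Rightarrow> bool" where
  "banach_bimodule A l r \<longleftrightarrow>
     (\<forall>a\<in>A. clinear_on UNIV (l a) \<and> clinear_on UNIV (r a)) \<and>
     (\<forall>x. clinear_on A (\<lambda>a. l a x) \<and> clinear_on A (\<lambda>a. r a x)) \<and>
     (\<forall>a\<in>A. \<forall>b\<in>A. \<forall>x. l (a * b) x = l a (l b x) \<and> r (a * b) x = r b (r a x) \<and>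
        r b (l a x) = l a (r b x)) \<and>
     (\<exists>K. \<forall>a\<in>A. \<forall>x. norm (l a x) \<le> K * norm a * norm x \<and> norm (r a x) \<le> K * norm a * norm x)"

text \<open>The dual space; its norm is the operator norm \<^const>\<open>onorm\<close>.\<close>

definition cdual :: "('x::complex_normed_vector \<Rightarrow> complex) set" where
  "cdual = {\<phi>. bounded_linear \<phi> \<and> (\<forall>c x. \<phi> (c *\<^sub>C x) = c * \<phi> x)}"

text \<open>
  The dual actions on \<^term>\<open>cdual\<close>: \<open>(a \<cdot> \<phi>)(x) = \<phi>(x \<cdot> a)\<close> and \<open>(\<phi> \<cdot> a)(x) = \<phi>(a \<cdot> x)\<close>.
\<close>

definition dual_left :: "('a \<Rightarrow> 'x \<Rightarrow> 'x) \<Rightarrow> 'a \<Rightarrow> ('x \<Rightarrow> complex) \<Rightarrow> 'x \<Rightarrow> complex" where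
  "dual_left r a \<phi> = (\<lambda>x. \<phi> (r a x))"

definition dual_right :: "('a \<Rightarrow> 'x \<Rightarrow> 'x) \<Rightarrow> 'a \<Rightarrow> ('x \<Rightarrow> complex) \<Rightarrow> 'x \<Rightarrow> complex" where
  "dual_right l a \<phi> = (\<lambda>x. \<phi> (l a x))"

definition bounded_dual_derivation ::
  "'a::complex_normed_algebra set \<Rightarrow> ('a \<Rightarrow> 'x \<Rightarrow> 'x) \<Rightarrow> ('a \<Rightarrow> 'x \<Rightarrow> 'x) \<Rightarrow>
     ('a \<Rightarrow> 'x::complex_normed_vector \<Rightarrow> complex) \<Rightarrow> bool" where
  "bounded_dual_derivation A l r D \<longleftrightarrow>
     (\<forall>a\<in>A. D a \<in> cdual) \<and>
     (\<forall>a\<in>A. \<forall>b\<in>A. \<forall>x. D (a + b) x = D a x + D b x) \<and>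
     (\<forall>c. \<forall>a\<in>A. \<forall>x. D (c *\<^sub>C a) x = c * D a x) \<and>
     (\<exists>K. \<forall>a\<in>A. onorm (D a) \<le> K * norm a) \<and>
     (\<forall>a\<in>A. \<forall>b\<in>A. \<forall>x. D (a * b) x = dual_left r a (D b) x + dual_right l b (D a) x)"

definition inner_dual_derivation ::
  "'a::complex_normed_algebra set \<Rightarrow> ('a \<Rightarrow> 'x \<Rightarrow> 'x) \<Rightarrow> ('a \<Rightarrow> 'x \<Rightarrow> 'x) \<Rightarrow>
     ('a \<Rightarrow> 'x::complex_normed_vector \<Rightarrow> complex) \<Rightarrow> bool" where
  "inner_dual_derivation A l r D \<longleftrightarrow>
     (\<exists>\<phi>\<in>cdual. \<forall>a\<in>A. \<forall>x. D a x = dual_left r a \<phi> x - dual_right l a \<phi> x)"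

text \<open>
  A definition in HOL cannot quantify over all Banach spaces, so the type \<open>'x\<close> that
  carries the bimodules is a parameter. \<open>A\<close> is amenable if \<open>amenable TYPE('x) A\<close> holds for
  every type \<open>'x\<close>; a theorem with conclusion \<open>amenable TYPE('x) A\<close> in which \<open>'x\<close> is a
  type variable, not occurring elsewhere, says exactly this.
\<close>

definition amenable ::
  "'x::{complex_normed_vector, banach} itself \<Rightarrow> 'a::complex_normed_algebra set \<Rightarrow> bool" where
  "amenable _ A \<longleftrightarrow>
     (\<forall>(l :: 'a \<Rightarrow> 'x \<Rightarrow> 'x) r D.
        banach_bimodule A l r \<longrightarrow> bounded_dual_derivation A l r D \<longrightarrow> inner_dual_derivation A l r D)"


section \<open>The convolution algebra \<open>\<ell>\<^sup>1(G)\<close> of a discrete abelian group\<close>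

lemma abs_summable_plus:
  fixes f g :: "'g \<Rightarrow> complex"
  assumes "f abs_summable_on A" "g abs_summable_on A"
  shows "(\<lambda>x. f x + g x) abs_summable_on A"
  by (rule abs_summable_on_comparison_test'[OF summable_on_add[OF assms]]) (rule norm_triangle_ineq)

typedef 'g l1 = "{f :: 'g \<Rightarrow> complex. f abs_summable_on UNIV}"
  morphisms l1_coeff Abs_l1
  by (rule exI[of _ "\<lambda>_. 0"]) simp

setup_lifting type_definition_l1

lemma l1_coeff_abs_summable: "l1_coeff f abs_summable_on UNIV"
  using l1_coeff by blast

lemma l1_coeff_summable: "l1_coeff f summable_on UNIV"
  by (rule abs_summable_summable[OF l1_coeff_abs_summable])

instantiation l1 :: (type) real_vector
begin

lift_definition zero_l1 :: "'a l1" is "\<lambda>_. 0" by simp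

lift_definition plus_l1 :: "'a l1 \<Rightarrow> 'a l1 \<Rightarrow> 'a l1" is "\<lambda>f g x. f x + g x"
  by (rule abs_summable_plus)

lift_definition uminus_l1 :: "'a l1 \<Rightarrow> 'a l1" is "\<lambda>f x. - f x" by simp

lift_definition minus_l1 :: "'a l1 \<Rightarrow> 'a l1 \<Rightarrow> 'a l1" is "\<lambda>f g x. f x - g x"
  subgoal for f g using abs_summable_plus[of f UNIV "\<lambda>x. - g x"] by (simp del: add_uminus_conv_diff add: diff_conv_add_uminus)
  done

lift_definition scaleR_l1 :: "real \<Rightarrow> 'a l1 \<Rightarrow> 'a l1" is "\<lambda>r f x. r *\<^sub>R f x"
  by (simp add: summable_on_cmult_right)

instance
  by standard (transfer; simp add: fun_eq_iff algebra_simps)+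

end

instantiation l1 :: (type) complex_normed_vector
begin

lift_definition norm_l1 :: "'a l1 \<Rightarrow> real" is "\<lambda>f. \<Sum>\<^sub>\<infinity>x. norm (f x)" .

lift_definition scaleC_l1 :: "complex \<Rightarrow> 'a l1 \<Rightarrow> 'a l1" is "\<lambda>c f x. c * f x"
  by (simp add: norm_mult summable_on_cmult_right)

definition dist_l1 :: "'a l1 \<Rightarrow> 'a l1 \<Rightarrow> real" where
  "dist_l1 f g = norm (f - g)"

definition sgn_l1 :: "'a l1 \<Rightarrow> 'a l1" where
  "sgn_l1 f = f /\<^sub>R norm f"

definition uniformity_l1 :: "('a l1 \<times> 'a l1) filter" where
  "uniformity_l1 = (INF e\<in>{0<..}. principal {(x, y). dist x y < e})"

definition open_l1 :: "'a l1 set \<Rightarrow> bool" where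
  "open_l1 U = (\<forall>x\<in>U. eventually (\<lambda>(x', y). x' = x \<longrightarrow> y \<in> U) uniformity)"

instance
proof
  fix f g :: "'a l1" and r :: real and c d :: complex
  show "(norm f = 0) = (f = 0)"
  proof transfer
    fix f :: "'a \<Rightarrow> complex" assume f: "f abs_summable_on UNIV"
    show "((\<Sum>\<^sub>\<infinity>x. norm (f x)) = 0) = (f = (\<lambda>_. 0))"
    proof
      assume 0: "(\<Sum>\<^sub>\<infinity>x. norm (f x)) = 0"
      have "norm (f x) = 0" for x
        by (rule nonneg_infsum_le_0D[OF eq_refl[OF 0] f]) simp_all
      then show "f = (\<lambda>_. 0)" by (intro ext) (simp only: norm_eq_zero)
    qed simp
  qed
  show "norm (f + g) \<le> norm f + norm g"
  proof transfer
    fix f g :: "'a \<Rightarrow> complex"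
    assume f: "f abs_summable_on UNIV" and g: "g abs_summable_on UNIV"
    have "(\<Sum>\<^sub>\<infinity>x. norm (f x + g x)) \<le> (\<Sum>\<^sub>\<infinity>x. norm (f x) + norm (g x))"
      by (rule infsum_mono[OF abs_summable_plus[OF f g] summable_on_add[OF f g]]) (rule norm_triangle_ineq)
    also have "\<dots> = (\<Sum>\<^sub>\<infinity>x. norm (f x)) + (\<Sum>\<^sub>\<infinity>x. norm (g x))"
      by (rule infsum_add[OF f g])
    finally show "(\<Sum>\<^sub>\<infinity>x. norm (f x + g x)) \<le> (\<Sum>\<^sub>\<infinity>x. norm (f x)) + (\<Sum>\<^sub>\<infinity>x. norm (g x))" .
  qed
  show "norm (r *\<^sub>R f) = \<bar>r\<bar> * norm f"
    by transfer (simp add: infsum_cmult_right')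
  show "norm (c *\<^sub>C f) = cmod c * norm f"
    by transfer (simp add: norm_mult infsum_cmult_right')
  show "c *\<^sub>C (f + g) = c *\<^sub>C f + c *\<^sub>C g" "(c + d) *\<^sub>C f = c *\<^sub>C f + d *\<^sub>C f"
    "c *\<^sub>C d *\<^sub>C f = (c * d) *\<^sub>C f" "complex_of_real r *\<^sub>C f = r *\<^sub>R f"
    by (transfer; simp add: fun_eq_iff distrib_left distrib_right scaleR_conv_of_real)+
qed (simp_all add: dist_l1_def sgn_l1_def uniformity_l1_def open_l1_def)

end

lemma norm_l1_coeff_le: "norm (l1_coeff f x) \<le> norm f"
proof -
  have "(\<Sum>x\<in>{x}. norm (l1_coeff f x)) \<le> (\<Sum>\<^sub>\<infinity>x. norm (l1_coeff f x))"
    by (rule finite_sum_le_infsum) (auto intro: l1_coeff_abs_summable)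
  then show ?thesis by (simp add: norm_l1.rep_eq)
qed

instance l1 :: (type) banach
proof
  fix X :: "nat \<Rightarrow> 'a l1" assume X: "Cauchy X"
  have "Cauchy (\<lambda>n. l1_coeff (X n) x)" for x
  proof (rule metric_CauchyI)
    fix e :: real assume "e > 0"
    then obtain M where M: "\<And>m n. m \<ge> M \<Longrightarrow> n \<ge> M \<Longrightarrow> dist (X m) (X n) < e"
      using metric_CauchyD[OF X] by blast
    have "dist (l1_coeff (X m) x) (l1_coeff (X n) x) \<le> dist (X m) (X n)" for m n
      using norm_l1_coeff_le[of "X m - X n" x] by (simp add: dist_norm minus_l1.rep_eq)
    then have "dist (l1_coeff (X m) x) (l1_coeff (X n) x) < e" if "m \<ge> M" "n \<ge> M" for m n
      using M[OF that] by (rule le_less_trans)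
    then show "\<exists>M. \<forall>m\<ge>M. \<forall>n\<ge>M. dist (l1_coeff (X m) x) (l1_coeff (X n) x) < e"
      by blast
  qed
  then have "convergent (\<lambda>n. l1_coeff (X n) x)" for x
    by (rule Cauchy_convergent)
  then obtain f where f: "\<And>x. (\<lambda>n. l1_coeff (X n) x) \<longlonglongrightarrow> f x"
    unfolding convergent_def by metis
  have tail: "\<exists>M. \<forall>n\<ge>M. \<forall>S. finite S \<longrightarrow> (\<Sum>x\<in>S. norm (f x - l1_coeff (X n) x)) \<le> e"
    if "e > 0" for e
  proof -
    obtain M where M: "\<And>m n. m \<ge> M \<Longrightarrow> n \<ge> M \<Longrightarrow> dist (X m) (X n) < e"
      using metric_CauchyD[OF X \<open>e > 0\<close>] by blast
    have "(\<Sum>x\<in>S. norm (f x - l1_coeff (X n) x)) \<le> e" if "n \<ge> M" "finite S" for n S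
    proof (rule LIMSEQ_le_const2)
      show "(\<lambda>m. \<Sum>x\<in>S. norm (l1_coeff (X m) x - l1_coeff (X n) x))
          \<longlonglongrightarrow> (\<Sum>x\<in>S. norm (f x - l1_coeff (X n) x))"
        by (intro tendsto_sum tendsto_norm tendsto_diff f tendsto_const)
      have "(\<Sum>x\<in>S. norm (l1_coeff (X m) x - l1_coeff (X n) x)) \<le> e" if "m \<ge> M" for m
      proof -
        have "(\<Sum>x\<in>S. norm (l1_coeff (X m - X n) x)) \<le> (\<Sum>\<^sub>\<infinity>x. norm (l1_coeff (X m - X n) x))"
          by (rule finite_sum_le_infsum) (auto intro: l1_coeff_abs_summable \<open>finite S\<close>)
        also have "\<dots> = dist (X m) (X n)" by (simp add: dist_norm norm_l1.rep_eq)
        also have "\<dots> \<le> e" using M[OF that \<open>n \<ge> M\<close>] by simp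
        finally show ?thesis by (simp add: minus_l1.rep_eq)
      qed
      then show "\<exists>N. \<forall>m\<ge>N. (\<Sum>x\<in>S. norm (l1_coeff (X m) x - l1_coeff (X n) x)) \<le> e" by blast
    qed
    then show ?thesis by blast
  qed
  have diff: "(\<lambda>x. f x - l1_coeff (X n) x) abs_summable_on UNIV"
    if "\<And>S. finite S \<Longrightarrow> (\<Sum>x\<in>S. norm (f x - l1_coeff (X n) x)) \<le> e" for n e
    unfolding abs_summable_iff_bdd_above by (rule bdd_aboveI2[where M = e]) (use that in blast)
  obtain M where M: "\<And>S. finite S \<Longrightarrow> (\<Sum>x\<in>S. norm (f x - l1_coeff (X M) x)) \<le> 1"
    using tail[of 1] by auto
  have "f abs_summable_on UNIV"
    using abs_summable_plus[OF diff[OF M] l1_coeff_abs_summable[of "X M"]] by simp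
  then obtain F where F: "l1_coeff F = f"
    using Abs_l1_inverse[of f] by blast
  have "X \<longlonglongrightarrow> F"
  proof (rule metric_LIMSEQ_I)
    fix e :: real assume "e > 0"
    then obtain M where M: "\<And>n S. n \<ge> M \<Longrightarrow> finite S \<Longrightarrow>
        (\<Sum>x\<in>S. norm (f x - l1_coeff (X n) x)) \<le> e / 2"
      using tail[of "e / 2"] by auto
    have "dist (X n) F < e" if "n \<ge> M" for n
    proof -
      have "norm (F - X n) \<le> e / 2"
        unfolding norm_l1.rep_eq minus_l1.rep_eq F
        by (rule infsum_le_finite_sums) (use diff[OF M[OF that]] M[OF that] in auto)
      then show ?thesis using \<open>e > 0\<close> by (simp add: dist_norm norm_minus_commute)
    qed
    then show "\<exists>no. \<forall>n\<ge>no. dist (X n) F < e" by blast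
  qed
  then show "convergent X" by (auto simp: convergent_def)
qed

lemma bij_shift_pair: "bij (\<lambda>(x :: 'g::ab_group_add, y). (y, x - y))"
  by (rule bij_betwI[where g = "\<lambda>(y, z). (y + z, y)"]) auto

lemma bij_minus_right: "bij (\<lambda>y :: 'g::ab_group_add. y - z)"
  by (rule bij_betwI[where g = "\<lambda>y. y + z"]) auto

lemma abs_summable_conv_pair:
  fixes f g :: "'g::ab_group_add \<Rightarrow> complex"
  assumes "f abs_summable_on UNIV" "g abs_summable_on UNIV"
  shows "(\<lambda>(x, y). f y * g (x - y)) abs_summable_on UNIV \<times> UNIV"
proof -
  have "(\<lambda>(y, z). f y * g z) abs_summable_on UNIV \<times> UNIV"
    using assms by (subst abs_summable_on_Sigma_iff)
      (simp add: norm_mult infsum_cmult_right' summable_on_cmult_right summable_on_cmult_left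
        abs_mult infsum_nonneg)
  then have "(\<lambda>p. norm (case p of (y, z) \<Rightarrow> f y * g z)) summable_on UNIV" by simp
  then have "(\<lambda>p. norm (case (case p of (x, y) \<Rightarrow> (y, x - y)) of (y, z) \<Rightarrow> f y * g z)) summable_on UNIV"
    using summable_on_reindex_bij_betw[OF bij_shift_pair, of "\<lambda>p. norm (case p of (y, z) \<Rightarrow> f y * g z)"]
    by simp
  then show ?thesis by (simp add: case_prod_unfold)
qed

lemma abs_summable_conv:
  fixes f g :: "'g::ab_group_add \<Rightarrow> complex"
  assumes "f abs_summable_on UNIV" "g abs_summable_on UNIV"
  shows "(\<lambda>y. f y * g (x - y)) abs_summable_on UNIV"
  using abs_summable_conv_pair[OF assms] unfolding abs_summable_on_Sigma_iff by simp

lemma infsum_norm_conv: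
  fixes f g :: "'g::ab_group_add \<Rightarrow> complex"
  assumes "f abs_summable_on UNIV" "g abs_summable_on UNIV"
  shows "(\<lambda>x. \<Sum>\<^sub>\<infinity>y. f y * g (x - y)) abs_summable_on UNIV"
    and "(\<Sum>\<^sub>\<infinity>x. norm (\<Sum>\<^sub>\<infinity>y. f y * g (x - y))) \<le> (\<Sum>\<^sub>\<infinity>x. norm (f x)) * (\<Sum>\<^sub>\<infinity>x. norm (g x))"
proof -
  have pair: "(\<lambda>(x, y). norm (f y * g (x - y))) summable_on UNIV \<times> UNIV"
    using abs_summable_conv_pair[OF assms] by (simp add: case_prod_unfold)
  have s: "(\<lambda>x. \<Sum>\<^sub>\<infinity>y. norm (f y * g (x - y))) summable_on UNIV"
    by (rule summable_on_Sigma_banach[OF pair])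
  have le: "norm (\<Sum>\<^sub>\<infinity>y. f y * g (x - y)) \<le> (\<Sum>\<^sub>\<infinity>y. norm (f y * g (x - y)))" for x
    by (rule norm_infsum_bound[OF abs_summable_conv[OF assms]])
  show a: "(\<lambda>x. \<Sum>\<^sub>\<infinity>y. f y * g (x - y)) abs_summable_on UNIV"
    by (rule abs_summable_on_comparison_test'[OF s le])
  have "(\<Sum>\<^sub>\<infinity>x. norm (\<Sum>\<^sub>\<infinity>y. f y * g (x - y))) \<le> (\<Sum>\<^sub>\<infinity>x. \<Sum>\<^sub>\<infinity>y. norm (f y * g (x - y)))"
    by (rule infsum_mono[OF a s le])
  also have "\<dots> = (\<Sum>\<^sub>\<infinity>y. \<Sum>\<^sub>\<infinity>x. norm (f y * g (x - y)))"
    by (rule infsum_swap_banach[OF pair])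
  also have "\<dots> = (\<Sum>\<^sub>\<infinity>y. norm (f y) * (\<Sum>\<^sub>\<infinity>x. norm (g x)))"
    using infsum_reindex_bij_betw[OF bij_minus_right, of "\<lambda>x. norm (g x)"]
    by (simp add: norm_mult infsum_cmult_right')
  also have "\<dots> = (\<Sum>\<^sub>\<infinity>x. norm (f x)) * (\<Sum>\<^sub>\<infinity>x. norm (g x))"
    by (simp add: infsum_cmult_left')
  finally show "(\<Sum>\<^sub>\<infinity>x. norm (\<Sum>\<^sub>\<infinity>y. f y * g (x - y))) \<le> (\<Sum>\<^sub>\<infinity>x. norm (f x)) * (\<Sum>\<^sub>\<infinity>x. norm (g x))" .
qed

lemma conv_assoc:
  fixes f g h :: "'g::ab_group_add \<Rightarrow> complex"
  assumes f: "f abs_summable_on UNIV" and g: "g abs_summable_on UNIV" and h: "h abs_summable_on UNIV"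
  shows "(\<Sum>\<^sub>\<infinity>y. (\<Sum>\<^sub>\<infinity>z. f z * g (y - z)) * h (x - y)) =
    (\<Sum>\<^sub>\<infinity>z. f z * (\<Sum>\<^sub>\<infinity>w. g w * h (x - z - w)))"
proof -
  define C where "C = (\<Sum>\<^sub>\<infinity>x. norm (h x))"
  have hb: "norm (h v) \<le> C" for v
  proof -
    have "(\<Sum>x\<in>{v}. norm (h x)) \<le> (\<Sum>\<^sub>\<infinity>x. norm (h x))"
      by (rule finite_sum_le_infsum) (use h in auto)
    then show ?thesis by (simp add: C_def)
  qed
  have "(\<lambda>p. norm (case p of (y, z) \<Rightarrow> f z * g (y - z) * h (x - y))) summable_on UNIV \<times> UNIV"
  proof (rule abs_summable_on_comparison_test')
    show "(\<lambda>p. C * norm (case p of (y, z) \<Rightarrow> f z * g (y - z))) summable_on UNIV \<times> UNIV"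
      by (intro summable_on_cmult_right abs_summable_conv_pair f g)
    show "norm (case p of (y, z) \<Rightarrow> f z * g (y - z) * h (x - y)) \<le>
        C * norm (case p of (y, z) \<Rightarrow> f z * g (y - z))" for p
    proof (cases p)
      case (Pair y z)
      have "norm (f z * g (y - z)) * norm (h (x - y)) \<le> norm (f z * g (y - z)) * C"
        by (intro mult_left_mono hb) simp
      then show ?thesis by (simp add: Pair norm_mult mult_ac)
    qed
  qed
  then have sum: "(\<lambda>(y, z). f z * g (y - z) * h (x - y)) summable_on UNIV \<times> UNIV"
    by (rule abs_summable_summable)
  have inner: "(\<Sum>\<^sub>\<infinity>y. g (y - z) * h (x - y)) = (\<Sum>\<^sub>\<infinity>w. g w * h (x - z - w))" for z
    using infsum_reindex_bij_betw[OF bij_minus_right[of z], of "\<lambda>w. g w * h (x - z - w)"]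
    by simp
  have "(\<Sum>\<^sub>\<infinity>y. (\<Sum>\<^sub>\<infinity>z. f z * g (y - z)) * h (x - y)) =
      (\<Sum>\<^sub>\<infinity>y. \<Sum>\<^sub>\<infinity>z. f z * g (y - z) * h (x - y))"
    by (simp add: infsum_cmult_left')
  also have "\<dots> = (\<Sum>\<^sub>\<infinity>z. \<Sum>\<^sub>\<infinity>y. f z * g (y - z) * h (x - y))"
    by (rule infsum_swap_banach[OF sum])
  also have "\<dots> = (\<Sum>\<^sub>\<infinity>z. f z * (\<Sum>\<^sub>\<infinity>w. g w * h (x - z - w)))"
    by (simp add: infsum_cmult_right' mult.assoc inner)
  finally show ?thesis .
qed

instantiation l1 :: (ab_group_add) complex_normed_algebra
begin

lift_definition times_l1 :: "'a l1 \<Rightarrow> 'a l1 \<Rightarrow> 'a l1" is "\<lambda>f g x. \<Sum>\<^sub>\<infinity>y. f y * g (x - y)"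
  by (rule infsum_norm_conv(1))

instance
proof
  fix f g h :: "'a l1" and r :: real and c :: complex
  show "f * g * h = f * (g * h)"
    by transfer (simp add: fun_eq_iff conv_assoc)
  show "(f + g) * h = f * h + g * h"
    by transfer (simp add: fun_eq_iff distrib_right infsum_add abs_summable_summable abs_summable_conv)
  show "f * (g + h) = f * g + f * h"
    by transfer (simp add: fun_eq_iff distrib_left infsum_add abs_summable_summable abs_summable_conv)
  show "r *\<^sub>R f * g = r *\<^sub>R (f * g)"
    by transfer (simp add: fun_eq_iff scaleR_conv_of_real mult.assoc infsum_cmult_right')
  show "f * r *\<^sub>R g = r *\<^sub>R (f * g)"
    by transfer (simp add: fun_eq_iff scaleR_conv_of_real mult_ac flip: infsum_cmult_right')
  show "(c *\<^sub>C f) * g = c *\<^sub>C (f * g)"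
    by transfer (simp add: fun_eq_iff mult.assoc infsum_cmult_right')
  show "f * (c *\<^sub>C g) = c *\<^sub>C (f * g)"
    by transfer (simp add: fun_eq_iff mult_ac flip: infsum_cmult_right')
  show "norm (f * g) \<le> norm f * norm g"
    by transfer (rule infsum_norm_conv(2))
qed

end

lift_definition point_mass :: "'g \<Rightarrow> 'g l1" is "\<lambda>v x. if x = v then 1 else 0"
proof -
  fix v :: 'g
  have "(\<lambda>x. norm (if x = v then 1 else 0 :: complex)) summable_on UNIV \<longleftrightarrow>
      (\<lambda>x. norm (if x = v then 1 else 0 :: complex)) summable_on {v}"
    by (rule summable_on_cong_neutral) auto
  then show "(\<lambda>x. if x = v then 1 else 0 :: complex) abs_summable_on UNIV" by simp
qed


section \<open>The algebra \<open>\<ell>\<^sup>1(\<int>\<^sup>n/F)\<close>\<close>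

definition GL_int :: "(int^'n^'n) monoid" where
  "GL_int = \<lparr>carrier = {M. invertible M}, mult = (**), one = mat 1\<rparr>"

lemma group_GL_int: "group (GL_int :: (int^'n^'n) monoid)"
proof (rule groupI)
  fix M :: "int^'n^'n" assume "M \<in> carrier GL_int"
  then obtain N where "M ** N = mat 1" "N ** M = mat 1"
    by (auto simp: GL_int_def invertible_def)
  then show "\<exists>N\<in>carrier GL_int. N \<otimes>\<^bsub>GL_int\<^esub> M = \<one>\<^bsub>GL_int\<^esub>"
    by (intro bexI[of _ N]) (auto simp: GL_int_def invertible_def)
qed (auto simp: GL_int_def invertible_mult matrix_mul_assoc invertible_def[of "mat 1"])

definition orbit_mean :: "(int^'n^'n) set \<Rightarrow> int^'n \<Rightarrow> (int^'n) l1" where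
  "orbit_mean F v = (1 / of_nat (card F)) *\<^sub>C (\<Sum>\<alpha>\<in>F. point_mass (\<alpha> *v v))"

definition l1_quotient :: "(int^'n^'n) set \<Rightarrow> (int^'n) l1 set" where
  "l1_quotient F = closed_csubalgebra hull range (orbit_mean F)"

end

theory Submission
  imports Defs "HOL-Analysis.Function_Topology" "HOL-Analysis.Topology_Euclidean_Space"
begin

text \<open>
  Write \<open>c g\<close> for \<open>orbit_mean F g\<close>, \<open>A\<close> for the algebra \<open>l1_quotient F\<close> and \<open>k\<close> for the order of \<open>F\<close>.
  Amenability follows, as in Johnson's theorem, from a bounded approximate diagonal
  (\<open>amenable_if_weak_approximate_diagonal\<close>). A natural first attempt averages the tensors
  \<open>c (- g) \<otimes> c g\<close> over large boxes. The result asymptotically commutes with \<open>A\<close>, because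
  \<open>c v * c w\<close> is the mean of \<open>c (\<alpha> v + w)\<close> over \<open>\<alpha>\<close> in \<open>F\<close> and boxes are almost invariant under
  translation. But its image under multiplication is not close to \<open>1\<close>: it is an element \<open>u\<close> with
  \<open>k u = (\<Sum>\<alpha>\<in>F. f \<alpha>)\<close>, where \<open>f \<alpha>\<close> is a mean of point masses over the subgroup of all \<open>\<alpha> g - g\<close>
  (\<open>mean_orbit_mean_mult\<close>). On the dual torus, \<open>u\<close> tends to the function that maps a character to the
  order of its stabiliser divided by \<open>k\<close>; this function is not continuous, but it is at least
  \<open>1 / k\<close> everywhere and takes only the values \<open>j / k\<close> with \<open>1 \<le> j \<le> k\<close>. Hence \<open>u\<close> should satisfy
  \<open>(\<Prod>j=1..k. 1 - (k / j) u) = 0\<close>, which makes it invertible with an inverse that is a polynomial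
  in \<open>u\<close>; multiplying by this inverse repairs the diagonal.
  
  Without characters or second duals, the reason for the polynomial identity is that the \<open>f \<alpha>\<close> are
  commuting idempotents and \<open>f 1 = 1\<close>. For means over boxes idempotence holds only in the form that
  \<open>f \<alpha>\<close> at a much larger scale absorbs \<open>f \<alpha>\<close> at a smaller one (\<open>coboundary_mean_absorb\<close>).
  Therefore the factors of the product are taken at \<open>k\<close> different scales, each much larger than the
  next (\<open>scale_sequence\<close>), and \<open>absorbing_product_tendsto_0\<close> shows that the product tends to \<open>0\<close> in
  norm. Expanding one minus this product by telescoping (\<open>one_minus_prod_one_minus\<close>) writes an
  approximation of \<open>1\<close> as a sum of terms \<open>\<beta> * u\<close> with bounded \<open>\<beta>\<close> in \<open>A\<close>, one for each scale, and the
  same coefficients \<open>\<beta>\<close> turn the first attempts at the \<open>k\<close> scales into an approximate diagonal.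
\<close>

section \<open>Amenability from a weak approximate diagonal\<close>

text \<open>
  Tychonoff's theorem stands in for weak-* compactness of balls in a dual space: \<open>G\<close> refines \<open>F\<close>, so
  everything that converges along \<open>F\<close> keeps its limit along \<open>G\<close>.
\<close>

lemma pointwise_cluster_point:
  fixes \<phi> :: "'i \<Rightarrow> 'x \<Rightarrow> 'b::topological_space"
  assumes "F \<noteq> bot" and "\<And>x. compact (K x)" and "\<And>t x. \<phi> t x \<in> K x"
  obtains \<psi> G where "G \<noteq> bot" "G \<le> F" "\<And>x. ((\<lambda>t. \<phi> t x) \<longlongrightarrow> \<psi> x) G"
proof -
  have "compact (PiE UNIV K)"
    using compactin_PiE[of "\<lambda>_::'x. euclidean :: 'b topology" UNIV K] assms(2)
    by (simp add: euclidean_product_topology)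
  moreover have "filtermap \<phi> F \<noteq> bot" using assms(1) by (simp add: filtermap_bot_iff)
  moreover have "eventually (\<lambda>f. f \<in> PiE UNIV K) (filtermap \<phi> F)"
    using assms(3) by (auto simp: eventually_filtermap PiE_UNIV_domain)
  ultimately obtain \<psi> where \<psi>: "inf (nhds \<psi>) (filtermap \<phi> F) \<noteq> bot"
    unfolding compact_filter by blast
  define G where "G = inf (filtercomap \<phi> (nhds \<psi>)) F"
  have "G \<noteq> bot"
  proof
    assume "G = bot"
    then have "eventually (\<lambda>_. False) G" by simp
    then obtain P Q where P: "eventually P (nhds \<psi>)" and Q: "eventually Q F"
      and PQ: "\<And>t. P (\<phi> t) \<Longrightarrow> Q t \<Longrightarrow> False"
      unfolding G_def eventually_inf eventually_filtercomap by blast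
    have "eventually (\<lambda>f. \<exists>t. Q t \<and> f = \<phi> t) (filtermap \<phi> F)"
      unfolding eventually_filtermap using Q by (rule eventually_mono) blast
    with P PQ have "eventually (\<lambda>_. False) (inf (nhds \<psi>) (filtermap \<phi> F))"
      unfolding eventually_inf by blast
    with \<psi> show False by (simp add: trivial_limit_def)
  qed
  moreover have "G \<le> F" unfolding G_def by (rule inf_le2)
  moreover have "((\<lambda>t. \<phi> t x) \<longlongrightarrow> \<psi> x) G" for x
  proof -
    have "(\<phi> \<longlongrightarrow> \<psi>) G"
      unfolding G_def by (rule filterlim_mono[OF filterlim_filtercomap order.refl inf_le1])
    then show ?thesis
      using continuous_on_tendsto_compose[OF continuous_on_product_coordinates[of x]] by simp
  qed
  ultimately show thesis by (rule that)
qed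

text \<open>
  Bounded bilinear forms on \<open>A\<close> are the functionals on the projective tensor square of \<open>A\<close>, so
  evaluating families of pairs on them gives the weak topology of that tensor square without
  constructing it.
\<close>

definition bounded_bilinear_form_on ::
  "'a::complex_normed_algebra set \<Rightarrow> ('a \<Rightarrow> 'a \<Rightarrow> complex) \<Rightarrow> bool" where
  "bounded_bilinear_form_on A T \<longleftrightarrow>
     (\<forall>a\<in>A. \<forall>b\<in>A. \<forall>c\<in>A. T (a + b) c = T a c + T b c \<and> T c (a + b) = T c a + T c b) \<and>
     (\<forall>z. \<forall>a\<in>A. \<forall>b\<in>A. T (z *\<^sub>C a) b = z * T a b \<and> T a (z *\<^sub>C b) = z * T a b) \<and>
     (\<exists>K. \<forall>a\<in>A. \<forall>b\<in>A. cmod (T a b) \<le> K * norm a * norm b)"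

lemma csubalgebra_closure:
  assumes "csubalgebra A"
  shows "0 \<in> A" "a \<in> A \<Longrightarrow> b \<in> A \<Longrightarrow> a + b \<in> A" "a \<in> A \<Longrightarrow> b \<in> A \<Longrightarrow> a * b \<in> A"
    "a \<in> A \<Longrightarrow> c *\<^sub>C a \<in> A" "a \<in> A \<Longrightarrow> r *\<^sub>R a \<in> A" "a \<in> A \<Longrightarrow> - a \<in> A"
    "a \<in> A \<Longrightarrow> b \<in> A \<Longrightarrow> a - b \<in> A" "(\<And>i. i \<in> I \<Longrightarrow> f i \<in> A) \<Longrightarrow> sum f I \<in> A"
proof -
  show 1: "0 \<in> A" "\<And>a b. a \<in> A \<Longrightarrow> b \<in> A \<Longrightarrow> a + b \<in> A" "a \<in> A \<Longrightarrow> b \<in> A \<Longrightarrow> a * b \<in> A"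
    "\<And>c a. a \<in> A \<Longrightarrow> c *\<^sub>C a \<in> A"
    using assms by (auto simp: csubalgebra_def)
  show 2: "a \<in> A \<Longrightarrow> r *\<^sub>R a \<in> A" for a r
    using 1(4) by (metis scaleC_of_real)
  show 3: "a \<in> A \<Longrightarrow> - a \<in> A" for a using 2[of a "-1"] by simp
  show "a \<in> A \<Longrightarrow> b \<in> A \<Longrightarrow> a - b \<in> A"
    using 1(2)[of a "-b"] 3[of b] by simp
  show "(\<And>i. i \<in> I \<Longrightarrow> f i \<in> A) \<Longrightarrow> sum f I \<in> A"
    by (induction I rule: infinite_finite_induct) (auto intro: 1)
qed

lemma norm_cdual_le: "\<phi> \<in> cdual \<Longrightarrow> cmod (\<phi> x) \<le> onorm \<phi> * norm x"
  unfolding cdual_def by (simp add: onorm)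

lemma sum_additive_on:
  assumes A: "csubalgebra A" and add: "\<And>a b. a \<in> A \<Longrightarrow> b \<in> A \<Longrightarrow> f (a + b) = f a + (f b :: 'b::ab_group_add)"
    and g: "\<And>i. i \<in> I \<Longrightarrow> g i \<in> A"
  shows "f (sum g I) = (\<Sum>i\<in>I. f (g i))"
proof -
  have f0: "f 0 = 0" using add[of 0 0] A by (simp add: csubalgebra_closure)
  show ?thesis using g
    by (induction I rule: infinite_finite_induct) (auto simp: f0 add csubalgebra_closure[OF A])
qed

locale dual_derivation =
  fixes A :: "'a::complex_normed_algebra set"
    and l r :: "'a \<Rightarrow> 'x::{complex_normed_vector, banach} \<Rightarrow> 'x"
    and D :: "'a \<Rightarrow> 'x \<Rightarrow> complex"
  assumes subalg: "csubalgebra A"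
    and bimodule: "banach_bimodule A l r"
    and derivation: "bounded_dual_derivation A l r D"
begin

lemma action_linear:
  assumes "a \<in> A"
  shows "l a (x + y) = l a x + l a y" "r a (x + y) = r a x + r a y"
    "l a (c *\<^sub>C x) = c *\<^sub>C l a x" "r a (c *\<^sub>C x) = c *\<^sub>C r a x"
    "l (c *\<^sub>C a) x = c *\<^sub>C l a x" "r (c *\<^sub>C a) x = c *\<^sub>C r a x"
  using bimodule assms unfolding banach_bimodule_def clinear_on_def by auto

lemma action_alg:
  assumes "a \<in> A" "b \<in> A"
  shows "l (a + b) x = l a x + l b x" "r (a + b) x = r a x + r b x"
    "l (a * b) x = l a (l b x)" "r (a * b) x = r b (r a x)" "r b (l a x) = l a (r b x)"
  using bimodule assms unfolding banach_bimodule_def clinear_on_def by auto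

lemma D_simps:
  assumes "a \<in> A"
  shows "D a (x + y) = D a x + D a y" "D a (c *\<^sub>C x) = c * D a x" "D a 0 = 0"
    "D a (x - y) = D a x - D a y"
proof -
  have *: "bounded_linear (D a)" "\<forall>c x. D a (c *\<^sub>C x) = c * D a x"
    using derivation assms unfolding bounded_dual_derivation_def cdual_def by auto
  interpret bounded_linear "D a" by fact
  show "D a (x + y) = D a x + D a y" "D a (c *\<^sub>C x) = c * D a x" "D a 0 = 0"
    "D a (x - y) = D a x - D a y"
    using * by (auto simp: add zero diff)
qed

lemma D_alg:
  assumes "a \<in> A" "b \<in> A"
  shows "D (a + b) x = D a x + D b x" "D (c *\<^sub>C a) x = c * D a x"
    "D (a * b) x = D b (r a x) + D a (l b x)"
  using derivation assms
  unfolding bounded_dual_derivation_def dual_left_def dual_right_def by auto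

lemma r_minus: "a \<in> A \<Longrightarrow> b \<in> A \<Longrightarrow> r (a - b) x = r a x - r b x"
  using action_alg(2)[of "a - b" b x] csubalgebra_closure[OF subalg] by (simp add: algebra_simps)

lemma action_bound:
  obtains K where "K \<ge> 0" "\<And>a x. a \<in> A \<Longrightarrow> norm (l a x) \<le> K * norm a * norm x"
    "\<And>a x. a \<in> A \<Longrightarrow> norm (r a x) \<le> K * norm a * norm x"
proof -
  obtain K where K: "\<And>a x. a \<in> A \<Longrightarrow> norm (l a x) \<le> K * norm a * norm x"
    "\<And>a x. a \<in> A \<Longrightarrow> norm (r a x) \<le> K * norm a * norm x"
    using bimodule unfolding banach_bimodule_def by blast
  have "K * norm a * norm x \<le> \<bar>K\<bar> * norm a * norm x" for a :: 'a and x :: 'x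
    by (intro mult_right_mono) auto
  then show thesis using K by (intro that[of "\<bar>K\<bar>"]) (meson order_trans abs_ge_zero)+
qed

lemma D_bound:
  obtains K where "K \<ge> 0" "\<And>a x. a \<in> A \<Longrightarrow> cmod (D a x) \<le> K * norm a * norm x"
proof -
  have dual: "D a \<in> cdual" if "a \<in> A" for a
    using derivation that unfolding bounded_dual_derivation_def by simp
  have "\<exists>K. \<forall>a\<in>A. onorm (D a) \<le> K * norm a"
    using derivation unfolding bounded_dual_derivation_def by simp
  then obtain K where K: "\<And>a. a \<in> A \<Longrightarrow> onorm (D a) \<le> K * norm a"
    by blast
  have "cmod (D a x) \<le> \<bar>K\<bar> * norm a * norm x" if "a \<in> A" for a x
  proof -
    have "cmod (D a x) \<le> onorm (D a) * norm x" using norm_cdual_le[OF dual[OF that]] .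
    also have "\<dots> \<le> (K * norm a) * norm x" by (intro mult_right_mono K that) auto
    also have "\<dots> \<le> \<bar>K\<bar> * norm a * norm x" by (intro mult_right_mono) auto
    finally show ?thesis .
  qed
  then show thesis by (intro that[of "\<bar>K\<bar>"]) auto
qed

text \<open>
  Both sides are bounded derivations, and two bounded derivations that agree on \<open>S\<close> agree on the
  closed subalgebra generated by \<open>S\<close>. Here \<open>E\<close> is the difference of the two derivations.
\<close>

lemma derivation_eq_on_hull:
  assumes "A = closed_csubalgebra hull S"
    and \<phi>: "\<phi> \<in> cdual" and S: "\<And>s x. s \<in> S \<Longrightarrow> D s x = \<phi> (r s x) - \<phi> (l s x)"
    and "a \<in> A"
  shows "D a x = \<phi> (r a x) - \<phi> (l a x)"
proof -
  interpret \<phi>: bounded_linear \<phi> using \<phi> by (simp add: cdual_def)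
  have \<phi>C: "\<phi> (c *\<^sub>C x) = c * \<phi> x" for c x using \<phi> by (simp add: cdual_def)
  define Z where "Z = {a \<in> A. \<forall>x. D a x = \<phi> (r a x) - \<phi> (l a x)}"
  have A: "closed A" using assms(1) closed_csubalgebra_hull unfolding closed_csubalgebra_def by metis
  obtain K where K: "K \<ge> 0" "\<And>a x. a \<in> A \<Longrightarrow> norm (l a x) \<le> K * norm a * norm x"
    "\<And>a x. a \<in> A \<Longrightarrow> norm (r a x) \<le> K * norm a * norm x"
    using action_bound by blast
  obtain K' where K': "K' \<ge> 0" "\<And>a x. a \<in> A \<Longrightarrow> cmod (D a x) \<le> K' * norm a * norm x"
    using D_bound by blast
  note sub = csubalgebra_closure[OF subalg]
  define E where "E a x = D a x - (\<phi> (r a x) - \<phi> (l a x))" for a x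
  have E_add: "E (a + b) x = E a x + E b x" if "a \<in> A" "b \<in> A" for a b x
    using that by (simp add: E_def D_alg action_linear action_alg \<phi>.add)
  have E_mult: "E (a * b) x = E b (r a x) + E a (l b x)" if "a \<in> A" "b \<in> A" for a b x
    using that by (simp add: E_def D_alg action_linear action_alg)
  have E_scale: "E (c *\<^sub>C a) x = c * E a x" if "a \<in> A" for a c x
    using that by (simp add: E_def D_alg action_linear action_alg \<phi>C algebra_simps)
  have Z: "Z = {a \<in> A. \<forall>x. E a x = 0}" by (simp add: Z_def E_def)
  obtain L where L: "L \<ge> 0" "\<And>x. cmod (\<phi> x) \<le> norm x * L"
    using \<phi>.nonneg_bounded by blast
  have E_bound: "cmod (E a x) \<le> (K' + 2 * L * K) * norm x * norm a" if "a \<in> A" for a x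
  proof -
    have "cmod (E a x) \<le> cmod (D a x) + (cmod (\<phi> (r a x)) + cmod (\<phi> (l a x)))"
      unfolding E_def by (intro order_trans[OF norm_triangle_ineq4] add_mono order.refl norm_triangle_ineq4)
    also have "cmod (D a x) \<le> K' * norm a * norm x" using K' that by blast
    also have "cmod (\<phi> (r a x)) \<le> (K * norm a * norm x) * L"
      using L K(3)[OF that] by (meson order_trans mult_right_mono)
    also have "cmod (\<phi> (l a x)) \<le> (K * norm a * norm x) * L"
      using L K(2)[OF that] by (meson order_trans mult_right_mono)
    finally show ?thesis by (simp add: algebra_simps)
  qed
  have "closed Z"
    unfolding closed_sequential_limits
  proof safe
    fix f y assume f: "\<forall>n. f n \<in> Z" "f \<longlonglongrightarrow> y"
    then have fA: "f n \<in> A" for n by (auto simp: Z)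
    have y: "y \<in> A" using closed_sequentially[OF A, of f y] fA f(2) by blast
    have "E y x = 0" for x
    proof -
      have "(\<lambda>n. cmod (E y x)) \<longlonglongrightarrow> 0"
      proof (rule tendsto_sandwich[OF _ _ tendsto_const])
        have "cmod (E y x) \<le> (K' + 2 * L * K) * norm x * norm (y - f n)" for n
        proof -
          have "E y x = E (f n) x + E (y - f n) x"
            using E_add[of "f n" "y - f n" x] fA y sub by simp
          then have "E y x = E (y - f n) x" using f(1) by (simp add: Z)
          then show ?thesis using E_bound[of "y - f n" x] fA y sub by simp
        qed
        then show "\<forall>\<^sub>F n in sequentially. cmod (E y x) \<le> (K' + 2 * L * K) * norm x * norm (y - f n)"
          by simp
        have "(\<lambda>n. (K' + 2 * L * K) * norm x * norm (y - f n)) \<longlonglongrightarrow> (K' + 2 * L * K) * norm x * norm (y - y)"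
          by (intro tendsto_intros f)
        then show "(\<lambda>n. (K' + 2 * L * K) * norm x * norm (y - f n)) \<longlonglongrightarrow> 0" by simp
      qed auto
      then show ?thesis by (simp add: LIMSEQ_const_iff)
    qed
    with y show "y \<in> Z" by (simp add: Z)
  qed
  moreover have "csubalgebra Z"
    unfolding csubalgebra_def Z using E_scale[of 0 0] sub
    by (auto simp: E_add E_mult E_scale) (metis E_add add_cancel_right_right)+
  ultimately have "closed_csubalgebra Z" by (simp add: closed_csubalgebra_def)
  moreover have "S \<subseteq> Z" using S assms(1) hull_subset[of S closed_csubalgebra] by (auto simp: Z_def)
  ultimately have "A \<subseteq> Z" unfolding assms(1) by (intro hull_minimal)
  with \<open>a \<in> A\<close> show ?thesis by (auto simp: Z_def)
qed

end


text \<open>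
  The sufficient half of Johnson's characterisation of amenability, with the commutation condition
  required only for generators and only in the weak topology of the projective tensor square.
  If \<open>\<psi>\<close> is a cluster point of the functionals \<open>\<Sum>i. a i \<cdot> D (b i)\<close>, the derivation rule and the
  condition \<open>comm\<close> give \<open>s \<cdot> \<psi> - \<psi> \<cdot> s = e \<cdot> D s\<close>. The bimodule need not be unital, and
  \<open>D s = e \<cdot> D s + D e \<cdot> s\<close>. The remaining term is inner as well: \<open>e \<cdot> D e \<cdot> e = 0\<close> shows that it is
  implemented by \<open>- (D e \<cdot> e)\<close>. So \<open>D\<close> is implemented by \<open>\<Phi> = \<psi> - D e \<cdot> e\<close>.
\<close>

theorem amenable_if_weak_approximate_diagonal:
  fixes S :: "'a::complex_normed_algebra set" and a b :: "nat \<Rightarrow> 'i \<Rightarrow> 'a"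
  assumes A: "A = closed_csubalgebra hull S"
    and e: "e \<in> A" "\<And>c. c \<in> A \<Longrightarrow> e * c = c" "\<And>c. c \<in> A \<Longrightarrow> c * e = c"
    and J: "\<And>t i. i \<in> J t \<Longrightarrow> a t i \<in> A" "\<And>t i. i \<in> J t \<Longrightarrow> b t i \<in> A"
    and bound: "\<And>t. (\<Sum>i\<in>J t. norm (a t i) * norm (b t i)) \<le> C"
    and unit: "(\<lambda>t. \<Sum>i\<in>J t. a t i * b t i) \<longlonglongrightarrow> e"
    and comm: "\<And>T s. bounded_bilinear_form_on A T \<Longrightarrow> s \<in> S \<Longrightarrow>
      (\<lambda>t. \<Sum>i\<in>J t. T (s * a t i) (b t i) - T (a t i) (b t i * s)) \<longlonglongrightarrow> 0"
  shows "amenable TYPE('x::{complex_normed_vector, banach}) A"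
  unfolding amenable_def
proof (intro allI impI)
  fix l r :: "'a \<Rightarrow> 'x \<Rightarrow> 'x" and D
  assume "banach_bimodule A l r" "bounded_dual_derivation A l r D"
  moreover have subalg: "csubalgebra A"
    using closed_csubalgebra_hull[of S] by (simp add: A closed_csubalgebra_def)
  ultimately interpret dual_derivation A l r D by unfold_locales
  note sub = csubalgebra_closure[OF subalg]
  obtain K where K: "K \<ge> 0" "\<And>a x. a \<in> A \<Longrightarrow> norm (l a x) \<le> K * norm a * norm x"
    "\<And>a x. a \<in> A \<Longrightarrow> norm (r a x) \<le> K * norm a * norm x"
    using action_bound by blast
  obtain K' where K': "K' \<ge> 0" "\<And>a x. a \<in> A \<Longrightarrow> cmod (D a x) \<le> K' * norm a * norm x"
    using D_bound by blast
  have DrK: "cmod (D b (r a x)) \<le> (K' * K * norm x) * (norm a * norm b)"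
    if "a \<in> A" "b \<in> A" for a b x
  proof -
    have "cmod (D b (r a x)) \<le> K' * norm b * norm (r a x)" using K' that by blast
    also have "\<dots> \<le> K' * norm b * (K * norm a * norm x)"
      using K' K(3) that by (intro mult_left_mono) auto
    finally show ?thesis by (simp add: mult_ac)
  qed
  define \<phi> where "\<phi> t x = (\<Sum>i\<in>J t. D (b t i) (r (a t i) x))" for t x
  have \<phi>_bound: "\<phi> t x \<in> cball 0 (K' * K * norm x * C)" for t x
  proof -
    have "cmod (\<phi> t x) \<le> (\<Sum>i\<in>J t. (K' * K * norm x) * (norm (a t i) * norm (b t i)))"
      unfolding \<phi>_def by (intro sum_norm_le DrK J)
    also have "\<dots> \<le> (K' * K * norm x) * C"
      unfolding sum_distrib_left[symmetric] using K K' by (intro mult_left_mono bound) auto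
    finally show ?thesis by simp
  qed
  obtain \<psi> G where G: "G \<noteq> bot" "G \<le> sequentially"
    and \<psi>: "\<And>x. ((\<lambda>t. \<phi> t x) \<longlongrightarrow> \<psi> x) G"
    by (rule pointwise_cluster_point[OF trivial_limit_sequentially compact_cball \<phi>_bound]) (rule that)
  have \<psi>_unique: "\<psi> x = L" if "((\<lambda>t. \<phi> t x) \<longlongrightarrow> L) G" for x L
    using tendsto_unique[OF G(1) \<psi> that] .
  have \<psi>_add: "\<psi> (x + y) = \<psi> x + \<psi> y" for x y
  proof (rule \<psi>_unique)
    have "\<phi> t (x + y) = \<phi> t x + \<phi> t y" for t
      unfolding \<phi>_def sum.distrib[symmetric]
      by (intro sum.cong refl) (simp add: action_linear D_simps J)
    then show "((\<lambda>t. \<phi> t (x + y)) \<longlongrightarrow> \<psi> x + \<psi> y) G" by (auto intro: tendsto_add \<psi>)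
  qed
  have \<psi>_scale: "\<psi> (c *\<^sub>C x) = c * \<psi> x" for c x
  proof (rule \<psi>_unique)
    have "\<phi> t (c *\<^sub>C x) = c * \<phi> t x" for t
      unfolding \<phi>_def sum_distrib_left
      by (intro sum.cong refl) (simp add: action_linear D_simps J)
    then show "((\<lambda>t. \<phi> t (c *\<^sub>C x)) \<longlongrightarrow> c * \<psi> x) G" by (auto intro: tendsto_mult_left \<psi>)
  qed
  have \<psi>_bound: "cmod (\<psi> x) \<le> norm x * (K' * K * C)" for x
    using tendsto_upperbound[OF tendsto_norm[OF \<psi>[of x]] _ G(1), of "K' * K * norm x * C"] \<phi>_bound
    by (simp add: mult_ac)
  have \<psi>_diff: "\<psi> (r s x) - \<psi> (l s x) = D s (r e x)" if s: "s \<in> S" for s x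
  proof -
    have sA: "s \<in> A" using s unfolding A by (rule hull_inc)
    define T where "T = (\<lambda>a b. D b (r a x))"
    have "bounded_bilinear_form_on A T"
      unfolding bounded_bilinear_form_on_def T_def
      using DrK by (auto simp: D_alg action_linear action_alg D_simps mult.assoc intro!: exI[of _ "K' * K * norm x"])
    note T0 = comm[OF this s]
    have eq: "\<phi> t (r s x) - \<phi> t (l s x) =
        (\<Sum>i\<in>J t. T (s * a t i) (b t i) - T (a t i) (b t i * s)) + D s (r (\<Sum>i\<in>J t. a t i * b t i) x)" for t
    proof -
      have "D s (r (\<Sum>i\<in>J t. a t i * b t i) x) = (\<Sum>i\<in>J t. D s (r (a t i * b t i) x))"
        using sA by (intro sum_additive_on[OF subalg, of "\<lambda>u. D s (r u x)"])
          (auto simp: D_simps action_linear action_alg intro!: sub J)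
      moreover have "D (b t i) (r (a t i) (r s x)) - D (b t i) (r (a t i) (l s x)) =
          T (s * a t i) (b t i) - T (a t i) (b t i * s) + D s (r (a t i * b t i) x)" if i: "i \<in> J t" for i
        using J[OF i] sA by (simp add: T_def D_alg action_linear action_alg)
      ultimately show ?thesis
        unfolding \<phi>_def by (simp add: sum_subtractf[symmetric] sum.distrib[symmetric] cong: sum.cong)
    qed
    have conv: "(\<lambda>t. D s (r (\<Sum>i\<in>J t. a t i * b t i) x)) \<longlonglongrightarrow> D s (r e x)"
    proof (rule Lim_null_comparison[THEN LIM_zero_cancel])
      define p where "p t = (\<Sum>i\<in>J t. a t i * b t i)" for t
      have p: "p t \<in> A" for t unfolding p_def by (intro sub(8) sub(3) J)
      have "cmod (D s (r (p t) x) - D s (r e x)) \<le> K' * K * norm x * (norm (p t - e) * norm s)" for t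
      proof -
        have "D s (r (p t) x) - D s (r e x) = D s (r (p t - e) x)"
          using p[of t] e(1) sA by (simp add: r_minus D_simps)
        then show ?thesis using DrK[of "p t - e" s x] p[of t] e(1) sA by (simp add: sub)
      qed
      then show "\<forall>\<^sub>F t in sequentially. cmod (D s (r (\<Sum>i\<in>J t. a t i * b t i) x) - D s (r e x)) \<le>
          K' * K * norm x * (norm (p t - e) * norm s)"
        by (simp add: p_def)
      have "(\<lambda>t. K' * K * norm x * (norm (p t - e) * norm s)) \<longlonglongrightarrow> K' * K * norm x * (norm (e - e) * norm s)"
        using unit unfolding p_def by (intro tendsto_intros)
      then show "(\<lambda>t. K' * K * norm x * (norm (p t - e) * norm s)) \<longlonglongrightarrow> 0" by simp
    qed
    have "(\<lambda>t. \<phi> t (r s x) - \<phi> t (l s x)) \<longlonglongrightarrow> 0 + D s (r e x)"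
      unfolding eq by (intro tendsto_add T0 conv)
    then have "((\<lambda>t. \<phi> t (r s x) - \<phi> t (l s x)) \<longlongrightarrow> D s (r e x)) G"
      using G(2) by (auto intro: tendsto_mono)
    then show ?thesis using tendsto_unique[OF G(1) tendsto_diff[OF \<psi> \<psi>]] by blast
  qed
  define \<Phi> where "\<Phi> x = \<psi> x - D e (l e x)" for x
  \<comment> \<open>This says \<open>e \<cdot> D e \<cdot> e = 0\<close>; it follows from \<open>e * e = e\<close>.\<close>
  have ele: "D e (l e (r e x)) = 0" for x
    using D_alg(3)[of e e "l e x"] e by (simp add: action_linear action_alg flip: action_alg(3))
  have "\<Phi> \<in> cdual"
  proof -
    have "bounded_linear \<Phi>"
    proof (rule bounded_linear_intro)
      show "\<Phi> (x + y) = \<Phi> x + \<Phi> y" for x y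
        using e(1) by (simp add: \<Phi>_def \<psi>_add action_linear action_alg D_simps)
      show "\<Phi> (c *\<^sub>R x) = c *\<^sub>R \<Phi> x" for c x
        using e(1) by (simp add: \<Phi>_def \<psi>_scale action_linear action_alg D_simps scaleR_conv_of_real algebra_simps
            flip: scaleC_of_real)
      show "norm (\<Phi> x) \<le> norm x * (K' * K * C + K' * norm e * (K * norm e))" for x
      proof -
        have "cmod (\<Phi> x) \<le> cmod (\<psi> x) + cmod (D e (l e x))" unfolding \<Phi>_def by (rule norm_triangle_ineq4)
        also have "cmod (D e (l e x)) \<le> K' * norm e * norm (l e x)" using K' e by blast
        also have "\<dots> \<le> K' * norm e * (K * norm e * norm x)" using K' K(2) e by (intro mult_left_mono) auto
        finally show ?thesis using \<psi>_bound[of x] by (simp add: algebra_simps)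
      qed
    qed
    then show ?thesis
      using e(1) by (simp add: cdual_def \<Phi>_def \<psi>_scale action_linear action_alg D_simps algebra_simps)
  qed
  moreover have "D a x = \<Phi> (r a x) - \<Phi> (l a x)" if "a \<in> A" for a x
  proof (rule derivation_eq_on_hull[OF A \<open>\<Phi> \<in> cdual\<close> _ that])
    fix s x assume s: "s \<in> S"
    have sA: "s \<in> A" using s unfolding A by (rule hull_inc)
    have "D s x = D s (r e x) + D e (l s x)"
      using D_alg(3)[of e s x] e sA by simp
    moreover have "D e (l e (l s x)) = D e (l s x)"
      using e sA by (simp flip: action_alg(3))
    moreover have "D e (l e (r s x)) = 0"
      using ele[of "r s x"] action_alg(4)[of s e x] e sA by simp
    ultimately show "D s x = \<Phi> (r s x) - \<Phi> (l s x)"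
      unfolding \<Phi>_def using \<psi>_diff[OF s, of x] by (simp add: algebra_simps)
  qed
  ultimately show "inner_dual_derivation A l r D"
    unfolding inner_dual_derivation_def dual_left_def dual_right_def by blast
qed

section \<open>Almost idempotent elements at different scales\<close>

lemma tendsto_mult_bounded_zero:
  fixes x w :: "nat \<Rightarrow> 'a::real_normed_algebra"
  assumes "x \<longlonglongrightarrow> 0" and "\<And>t. norm (w t) \<le> C"
  shows "(\<lambda>t. x t * w t) \<longlonglongrightarrow> 0"
proof (rule Lim_null_comparison)
  show "\<forall>\<^sub>F t in sequentially. norm (x t * w t) \<le> norm (x t) * C"
    using assms(2) by (intro always_eventually allI order_trans[OF norm_mult_ineq] mult_left_mono) auto
  show "(\<lambda>t. norm (x t) * C) \<longlonglongrightarrow> 0"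
    using tendsto_mult_right[OF tendsto_norm_zero[OF assms(1)], of C] by simp
qed

text \<open>
  The asymptotic version of an identity for commuting idempotents \<open>f i\<close>, \<open>i \<in> I\<close>: if \<open>y * f i = y\<close>
  for all \<open>i \<in> T\<close>, then \<open>y * (\<Prod>j=card T..card I. j - (\<Sum>i\<in>I. f i)) = 0\<close>, since on the image of \<open>y\<close> the
  sum of the idempotents can only take the values \<open>card T, \<dots>, card I\<close>.
  
  The induction adds elements to \<open>T\<close>. The factor with \<open>j = card T\<close> cancels the contribution of \<open>T\<close> to
  the sum, so that \<open>y\<close> times this factor is close to \<open>- (\<Sum>i\<in>I - T. y * f i)\<close>, and \<open>y * f i\<close> absorbs
  the elements indexed by \<open>insert i T\<close>. It only has to absorb them at later positions \<open>k > j\<close>, which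
  is why it suffices that \<open>f i j\<close> absorbs \<open>f i k\<close> for \<open>j < k\<close>.
\<close>

lemma absorbing_product_tendsto_0:
  fixes f :: "'i \<Rightarrow> nat \<Rightarrow> nat \<Rightarrow> 'a::{real_normed_algebra_1, comm_ring_1}"
  assumes "finite I"
    and f_bound: "\<And>i j t. i \<in> I \<Longrightarrow> norm (f i j t) \<le> 1"
    and absorb: "\<And>i j k. i \<in> I \<Longrightarrow> j < k \<Longrightarrow> k \<le> card I \<Longrightarrow>
      (\<lambda>t. f i j t * f i k t - f i j t) \<longlonglongrightarrow> 0"
    and "T \<subseteq> I"
    and "\<And>t. norm (y t) \<le> Y"
    and "\<And>i k. i \<in> T \<Longrightarrow> card T \<le> k \<Longrightarrow> k \<le> card I \<Longrightarrow> (\<lambda>t. y t * f i k t - y t) \<longlonglongrightarrow> 0"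
  shows "(\<lambda>t. y t * (\<Prod>j = card T..card I. of_nat j - (\<Sum>i\<in>I. f i j t))) \<longlonglongrightarrow> 0"
  using assms(4-)
proof (induction "card I - card T" arbitrary: T y rule: less_induct)
  case less
  note y_bound = less.prems(2)
  define q where "q = card T"
  define P where "P t = (\<Prod>j = Suc q..card I. of_nat j - (\<Sum>i\<in>I. f i j t))" for t
  have "finite T" using less.prems(1) \<open>finite I\<close> finite_subset by blast
  have q: "q \<le> card I" unfolding q_def using less.prems(1) \<open>finite I\<close> by (rule card_mono[rotated])
  have P_bound: "norm (P t) \<le> (\<Prod>j = Suc q..card I. real j + card I)" for t
    unfolding P_def
  proof (intro order_trans[OF norm_prod_le] prod_mono conjI norm_ge_zero)
    fix j
    have "norm (\<Sum>i\<in>I. f i j t) \<le> (\<Sum>i\<in>I. 1)" by (intro sum_norm_le f_bound)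
    then show "norm (of_nat j - (\<Sum>i\<in>I. f i j t)) \<le> real j + card I"
      by (intro order_trans[OF norm_triangle_ineq4] add_mono) auto
  qed
  have split: "(\<Prod>j = card T..card I. of_nat j - (\<Sum>i\<in>I. f i j t)) =
      (of_nat q - (\<Sum>i\<in>I. f i q t)) * P t" for t
    unfolding P_def q_def[symmetric] using q by (rule prod.atLeast_Suc_atMost)
  have expand: "y t * ((of_nat q - (\<Sum>i\<in>I. f i q t)) * P t) =
      - (\<Sum>i\<in>T. y t * f i q t - y t) * P t - (\<Sum>i\<in>I - T. y t * f i q t * P t)" for t
  proof -
    have "(\<Sum>i\<in>I. f i q t) = (\<Sum>i\<in>T. f i q t) + (\<Sum>i\<in>I - T. f i q t)"
      using less.prems(1) \<open>finite I\<close> by (metis add.commute sum.subset_diff)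
    moreover have "y t * (\<Sum>i\<in>T. f i q t) = (\<Sum>i\<in>T. y t * f i q t - y t) + of_nat q * y t"
      by (simp add: sum_subtractf sum_distrib_left q_def)
    moreover have "(\<Sum>i\<in>I - T. y t * f i q t * P t) = y t * (\<Sum>i\<in>I - T. f i q t) * P t"
      by (simp add: sum_distrib_left sum_distrib_right)
    moreover have "y t * ((of_nat q - (u + v)) * P t) = (of_nat q * y t - y t * u) * P t - y t * v * P t" for u v
      by (simp add: algebra_simps)
    ultimately show ?thesis by simp
  qed
  have "(\<lambda>t. (\<Sum>i\<in>T. y t * f i q t - y t)) \<longlonglongrightarrow> 0"
    using less.prems q by (intro tendsto_null_sum) (auto simp: q_def)
  then have A: "(\<lambda>t. (\<Sum>i\<in>T. y t * f i q t - y t) * P t) \<longlonglongrightarrow> 0"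
    by (rule tendsto_mult_bounded_zero[OF _ P_bound])
  have B: "(\<lambda>t. y t * f i q t * P t) \<longlonglongrightarrow> 0" if i: "i \<in> I - T" for i
  proof -
    have c: "card (insert i T) = Suc q" using i \<open>finite T\<close> by (simp add: q_def)
    have "card (insert i T) \<le> card I" using i less.prems(1) \<open>finite I\<close> by (intro card_mono) auto
    have "(\<lambda>t. (y t * f i q t) * (\<Prod>j = card (insert i T)..card I. of_nat j - (\<Sum>i\<in>I. f i j t))) \<longlonglongrightarrow> 0"
    proof (rule less.hyps)
      fix i' k assume *: "i' \<in> insert i T" "card (insert i T) \<le> k" "k \<le> card I"
      show "(\<lambda>t. y t * f i q t * f i' k t - y t * f i q t) \<longlonglongrightarrow> 0"
      proof (cases "i' = i")
        case True
        have "(\<lambda>t. (f i q t * f i k t - f i q t) * y t) \<longlonglongrightarrow> 0"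
          using * c i by (intro tendsto_mult_bounded_zero[OF absorb y_bound]) auto
        then show ?thesis by (simp add: True algebra_simps)
      next
        case False
        then have "i' \<in> T" using * by simp
        then have "(\<lambda>t. (y t * f i' k t - y t) * f i q t) \<longlonglongrightarrow> 0"
          using * c i by (intro tendsto_mult_bounded_zero[OF less.prems(3) f_bound]) (auto simp: q_def)
        then show ?thesis by (simp add: algebra_simps)
      qed
    next
      show "norm (y t * f i q t) \<le> Y" for t
        using mult_mono[OF y_bound f_bound[of i q t]] i norm_ge_zero[of "y t"] y_bound[of t]
        by (auto intro: order_trans[OF norm_mult_ineq])
    qed (use i less.prems(1) c q \<open>card (insert i T) \<le> card I\<close> in \<open>auto simp: q_def\<close>)
    then show ?thesis by (simp add: c P_def)
  qed
  have "(\<lambda>t. \<Sum>i\<in>I - T. y t * f i q t * P t) \<longlonglongrightarrow> 0"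
    using B by (rule tendsto_null_sum)
  from tendsto_diff[OF tendsto_minus[OF A] this] show ?case
    unfolding split expand by simp
qed

lemma one_minus_prod_one_minus:
  fixes x :: "nat \<Rightarrow> 'a::comm_ring_1"
  shows "1 - (\<Prod>j<n. 1 - x j) = (\<Sum>i<n. (\<Prod>j<i. 1 - x j) * x i)"
  by (induction n) (simp_all add: algebra_simps)

text \<open>
  Simultaneous choice of \<open>k + 1\<close> scales \<open>N 0 t, \<dots>, N k t\<close>, each much larger than the next. They are
  successive members, in decreasing order, of one rapidly growing sequence \<open>s\<close> from which \<open>t\<close> cuts a
  window: \<open>s (p + 1)\<close> is so large that \<open>z n m\<close> is below \<open>1 / (p + 1)\<close> for all \<open>n \<ge> s (p + 1)\<close> and all
  \<open>m \<le> s p\<close>, not only for \<open>m = s p\<close>, which lets one condition on neighbours control all pairs.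
\<close>

lemma scale_sequence:
  fixes z :: "nat \<Rightarrow> nat \<Rightarrow> real"
  assumes "\<And>m. (\<lambda>n. z n m) \<longlonglongrightarrow> 0"
  obtains N :: "nat \<Rightarrow> nat \<Rightarrow> nat"
  where "\<And>j t. j \<le> k \<Longrightarrow> t \<le> N j t"
    and "\<And>i j. i < j \<Longrightarrow> j \<le> k \<Longrightarrow> (\<lambda>t. z (N i t) (N j t)) \<longlonglongrightarrow> 0"
proof -
  have "\<exists>s. \<forall>p. True \<and> s p < s (Suc p) \<and> (\<forall>m\<le>s p. \<forall>n\<ge>s (Suc p). \<bar>z n m\<bar> < 1 / Suc p)"
  proof (rule dependent_nat_choice)
    fix u p :: nat
    have "eventually (\<lambda>n. \<forall>m\<in>{..u}. \<bar>z n m\<bar> < 1 / Suc p) sequentially"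
    proof (intro eventually_ball_finite ballI finite_atMost)
      fix m
      show "eventually (\<lambda>n. \<bar>z n m\<bar> < 1 / Suc p) sequentially"
        using tendstoD[OF assms, of "1 / Suc p" m] by (simp add: dist_norm)
    qed
    then obtain n0 where "\<And>n m. n \<ge> n0 \<Longrightarrow> m \<le> u \<Longrightarrow> \<bar>z n m\<bar> < 1 / Suc p"
      unfolding eventually_sequentially by blast
    then show "\<exists>v. True \<and> u < v \<and> (\<forall>m\<le>u. \<forall>n\<ge>v. \<bar>z n m\<bar> < 1 / Suc p)"
      by (intro exI[of _ "max (Suc u) n0"]) auto
  qed simp
  then obtain s where s: "\<And>p. s p < s (Suc p)"
    and z: "\<And>p m n. m \<le> s p \<Longrightarrow> s (Suc p) \<le> n \<Longrightarrow> \<bar>z n m\<bar> < 1 / Suc p"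
    by blast
  have mono: "strict_mono s" using s by (simp add: strict_mono_Suc_iff)
  show thesis
  proof (rule that[of "\<lambda>j t. s (t + (k - j))"])
    show "t \<le> s (t + (k - j))" for j t
      using seq_suble[OF mono, of "t + (k - j)"] by simp
    fix i j assume ij: "i < j" "j \<le> k"
    show "(\<lambda>t. z (s (t + (k - i))) (s (t + (k - j)))) \<longlonglongrightarrow> 0"
    proof (rule Lim_null_comparison)
      have "\<bar>z (s (t + (k - i))) (s (t + (k - j)))\<bar> \<le> 1 / Suc t" for t
      proof -
        have "\<bar>z (s (t + (k - i))) (s (t + (k - j)))\<bar> < 1 / Suc (t + (k - j))"
          using ij by (intro z strict_mono_leD[OF mono]) auto
        also have "\<dots> \<le> 1 / Suc t" by (intro divide_left_mono) auto
        finally show ?thesis by simp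
      qed
      then show "eventually (\<lambda>t. norm (z (s (t + (k - i))) (s (t + (k - j)))) \<le> 1 / Suc t) sequentially"
        by simp
      show "(\<lambda>t. 1 / real (Suc t)) \<longlonglongrightarrow> 0" using LIMSEQ_inverse_real_of_nat by (simp add: inverse_eq_divide)
    qed
  qed
qed

section \<open>The unital Banach algebra \<open>\<ell>\<^sup>1\<close>\<close>

lemma infsum_single:
  fixes f :: "'a \<Rightarrow> 'b::{topological_comm_monoid_add, t2_space}"
  assumes "\<And>x. x \<noteq> v \<Longrightarrow> f x = 0"
  shows "(\<Sum>\<^sub>\<infinity>x. f x) = f v"
proof -
  have "(\<Sum>\<^sub>\<infinity>x. f x) = (\<Sum>\<^sub>\<infinity>x\<in>{v}. f x)"
    by (rule infsum_cong_neutral) (use assms in auto)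
  then show ?thesis by simp
qed

lemma point_mass_times_coeff: "l1_coeff (point_mass v * f) x = l1_coeff f (x - v)"
  unfolding times_l1.rep_eq point_mass.rep_eq by (subst infsum_single[of v]) auto

instantiation l1 :: (ab_group_add) one
begin

definition one_l1 :: "'a l1" where "one_l1 = point_mass 0"

instance ..

end

instance l1 :: (ab_group_add) comm_ring_1
proof
  fix f g :: "'a l1"
  show "f * g = g * f"
  proof (transfer, rule ext)
    fix f g :: "'a \<Rightarrow> complex" and x :: 'a
    have "bij (\<lambda>y. x - y)" by (rule bij_betwI[where g = "\<lambda>y. x - y"]) (auto simp: algebra_simps)
    from infsum_reindex_bij_betw[OF this, of "\<lambda>y. g y * f (x - y)"]
    show "(\<Sum>\<^sub>\<infinity>y. f y * g (x - y)) = (\<Sum>\<^sub>\<infinity>y. g y * f (x - y))"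
      by (simp add: mult.commute)
  qed
  show "(f + g) * h = f * h + g * h" for h by (rule distrib_right)
  show "1 * f = f"
    by (simp add: l1_coeff_inject[symmetric] fun_eq_iff one_l1_def point_mass_times_coeff)
  show "(0 :: 'a l1) \<noteq> 1"
    by (auto simp: l1_coeff_inject[symmetric] fun_eq_iff one_l1_def zero_l1.rep_eq point_mass.rep_eq)
qed

lemma norm_point_mass [simp]: "norm (point_mass v) = 1"
  unfolding norm_l1.rep_eq point_mass.rep_eq by (subst infsum_single[of v]) auto

instance l1 :: (ab_group_add) real_normed_algebra_1
  by standard (simp add: one_l1_def)

lemma point_mass_mult: "point_mass v * point_mass w = point_mass (v + w)"
  by (auto simp: l1_coeff_inject[symmetric] fun_eq_iff point_mass_times_coeff point_mass.rep_eq algebra_simps)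

section \<open>Averages\<close>

definition mean :: "'a set \<Rightarrow> ('a \<Rightarrow> 'b::real_vector) \<Rightarrow> 'b" where
  "mean A f = (1 / card A) *\<^sub>R sum f A"

lemma mean_cong: "(\<And>x. x \<in> A \<Longrightarrow> f x = g x) \<Longrightarrow> mean A f = mean A g"
  by (simp add: mean_def cong: sum.cong)

lemma mean_swap: "mean A (\<lambda>x. mean B (f x)) = mean B (\<lambda>y. mean A (\<lambda>x. f x y))"
  unfolding mean_def by (simp add: scaleR_sum_right[symmetric] mult.commute sum.swap[of _ A])

lemma mean_diff: "mean A (\<lambda>x. f x - g x) = mean A f - mean A g"
  by (simp add: mean_def sum_subtractf scaleR_diff_right)

lemma mean_const: "finite A \<Longrightarrow> A \<noteq> {} \<Longrightarrow> mean A (\<lambda>_. c) = c"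
  by (simp add: mean_def sum_constant_scaleR)

lemma mean_scaleR: "mean A (\<lambda>x. r *\<^sub>R f x) = r *\<^sub>R mean A f"
  by (simp add: mean_def mult.commute flip: scaleR_sum_right)

lemma mean_mult_left: "mean A (\<lambda>x. c * f x) = c * (mean A f :: 'b::real_algebra)"
  by (simp add: mean_def sum_distrib_left)

lemma mean_mult_right: "mean A (\<lambda>x. f x * c) = (mean A f :: 'b::real_algebra) * c"
  by (simp add: mean_def sum_distrib_right)

lemma mean_mult_mean:
  "mean A f * mean B g = mean A (\<lambda>x. mean B (\<lambda>y. f x * g y :: 'b::real_algebra))"
  by (simp add: mean_mult_left mean_mult_right)

lemma norm_mean_le:
  fixes f :: "'a \<Rightarrow> 'b::real_normed_vector"
  shows "norm (mean A f) \<le> mean A (\<lambda>x. norm (f x))"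
  unfolding mean_def by (simp add: divide_right_mono norm_sum)

lemma mean_mono:
  fixes f g :: "'a \<Rightarrow> real"
  shows "(\<And>x. x \<in> A \<Longrightarrow> f x \<le> g x) \<Longrightarrow> mean A f \<le> mean A g"
  unfolding mean_def by (simp add: divide_right_mono sum_mono)

lemma norm_mean_le_bound:
  assumes "finite A" "A \<noteq> {}" "\<And>x. x \<in> A \<Longrightarrow> norm (f x) \<le> C"
  shows "norm (mean A f) \<le> C"
  using order_trans[OF norm_mean_le mean_mono[of A "\<lambda>x. norm (f x)" "\<lambda>_. C"]] assms
  by (simp add: mean_const)

lemma tendsto_mean_0:
  fixes f :: "'t \<Rightarrow> 'a \<Rightarrow> 'b::real_normed_vector"
  assumes "\<And>x. x \<in> A \<Longrightarrow> ((\<lambda>t. f t x) \<longlongrightarrow> 0) G"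
  shows "((\<lambda>t. mean A (f t)) \<longlongrightarrow> 0) G"
  unfolding mean_def using tendsto_scaleR[OF tendsto_const tendsto_null_sum[of A "f"]] assms by fastforce

section \<open>Boxes as a Folner sequence\<close>

definition int_box :: "nat \<Rightarrow> (int^'n) set" where
  "int_box N = {g. \<forall>i. 0 \<le> g $ i \<and> g $ i \<le> int N}"

lemma card_int_cube:
  "finite {g :: int^'n. \<forall>i. a \<le> g $ i \<and> g $ i \<le> b}"
  "card {g :: int^'n. \<forall>i. a \<le> g $ i \<and> g $ i \<le> b} = nat (b - a + 1) ^ CARD('n)"
proof -
  have "bij_betw (\<lambda>f. \<chi> i. f i) (PiE UNIV (\<lambda>_. {a..b})) {g :: int^'n. \<forall>i. a \<le> g $ i \<and> g $ i \<le> b}"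
    by (rule bij_betwI[where g = "\<lambda>g i. g $ i"]) auto
  note * = bij_betw_finite[OF this] bij_betw_same_card[OF this]
  show "finite {g :: int^'n. \<forall>i. a \<le> g $ i \<and> g $ i \<le> b}"
    using *(1) by (simp add: finite_PiE)
  show "card {g :: int^'n. \<forall>i. a \<le> g $ i \<and> g $ i \<le> b} = nat (b - a + 1) ^ CARD('n)"
    using *(2) by (simp add: card_PiE add.commute)
qed

lemma finite_int_box [simp]: "finite (int_box N :: (int^'n) set)"
  and card_int_box: "card (int_box N :: (int^'n) set) = Suc N ^ CARD('n)"
  and int_box_nonempty [simp]: "int_box N \<noteq> ({} :: (int^'n) set)"
proof -
  show "finite (int_box N :: (int^'n) set)" unfolding int_box_def by (rule card_int_cube)
  show c: "card (int_box N :: (int^'n) set) = Suc N ^ CARD('n)"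
    unfolding int_box_def card_int_cube by (simp add: nat_add_distrib)
  then show "int_box N \<noteq> ({} :: (int^'n) set)" by auto
qed

definition box_defect :: "nat \<Rightarrow> int^'n \<Rightarrow> real" where
  "box_defect N w = card (sym_diff (int_box N) ((+) w ` int_box N)) / card (int_box N :: (int^'n) set)"

text \<open>
  If \<open>r\<close> bounds the coordinates of \<open>w\<close>, then the box with a margin of width \<open>r\<close> removed lies both in
  the box and in its translate by \<open>w\<close>, and its share of the box tends to \<open>1\<close>.
\<close>

lemma box_defect_tendsto_0: "(\<lambda>N. box_defect N (w :: int^'n)) \<longlonglongrightarrow> 0"
proof (rule Lim_null_comparison)
  define r where "r = nat (\<Sum>i\<in>UNIV. \<bar>w $ i\<bar>)"
  have r: "\<bar>w $ i\<bar> \<le> int r" for i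
    using member_le_sum[of i UNIV "\<lambda>i. \<bar>w $ i\<bar>"] unfolding r_def by (simp add: sum_nonneg)
  have "norm (box_defect N w) \<le> 2 - 2 * ((real N + 1 - 2 * real r) / (real N + 1)) ^ CARD('n)" if N: "N \<ge> 2 * r" for N
  proof -
    let ?W = "(+) w ` int_box N" and ?C = "{g :: int^'n. \<forall>i. int r \<le> g $ i \<and> g $ i \<le> int N - int r}"
    have "?C \<subseteq> ?W"
    proof
      fix g assume g: "g \<in> ?C"
      have "0 \<le> (g - w) $ i \<and> (g - w) $ i \<le> int N" for i
      proof -
        have "int r \<le> g $ i" "g $ i \<le> int N - int r" using g by blast+
        then show ?thesis using r[of i] unfolding vector_minus_component by linarith
      qed
      then have "g - w \<in> int_box N" by (simp add: int_box_def)
      then show "g \<in> ?W" by (intro image_eqI[of _ _ "g - w"]) auto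
    qed
    moreover have "?C \<subseteq> int_box N"
      unfolding int_box_def
    proof (intro subsetI CollectI allI)
      fix g :: "int^'n" and i
      assume "g \<in> ?C"
      then have "int r \<le> g $ i" "g $ i \<le> int N - int r" by blast+
      then show "0 \<le> g $ i \<and> g $ i \<le> int N" by linarith
    qed
    moreover have W: "finite ?W" "card ?W = card (int_box N :: (int^'n) set)"
      by (auto intro!: card_image inj_onI)
    ultimately have "card (int_box N - ?W) \<le> card (int_box N :: (int^'n) set) - card ?C"
      "card (?W - int_box N) \<le> card (int_box N :: (int^'n) set) - card ?C"
      using card_mono[of "int_box N - ?C" "int_box N - ?W"] card_mono[of "?W - ?C" "?W - int_box N"]
      by (auto simp: card_Diff_subset card_int_cube(1))
    moreover have "card ?C \<le> card (int_box N :: (int^'n) set)"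
      using \<open>?C \<subseteq> int_box N\<close> by (rule card_mono[OF finite_int_box])
    moreover have "card (sym_diff (int_box N) ?W) \<le> card (int_box N - ?W) + card (?W - int_box N)"
      by (rule card_Un_le)
    ultimately have "real (card (sym_diff (int_box N) ?W)) \<le> 2 * real (card (int_box N :: (int^'n) set)) - 2 * real (card ?C)"
      by linarith
    moreover have "real (card ?C) = (real N + 1 - 2 * real r) ^ CARD('n)"
      using N unfolding card_int_cube by (simp add: of_nat_diff algebra_simps)
    ultimately have "box_defect N w \<le> (2 * (real N + 1) ^ CARD('n) - 2 * (real N + 1 - 2 * real r) ^ CARD('n)) / (real N + 1) ^ CARD('n)"
      unfolding box_defect_def by (simp add: card_int_box divide_right_mono add.commute)
    also have "\<dots> = 2 - 2 * ((real N + 1 - 2 * real r) / (real N + 1)) ^ CARD('n)"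
      by (simp add: power_divide field_simps)
    finally show ?thesis by (simp add: box_defect_def)
  qed
  then show "\<forall>\<^sub>F N in sequentially. norm (box_defect N w) \<le>
      2 - 2 * ((real N + 1 - 2 * real r) / (real N + 1)) ^ CARD('n)"
    by (rule eventually_sequentiallyI)
  have "(\<lambda>N. 2 - 2 * (1 - 2 * real r * inverse (real (Suc N))) ^ CARD('n)) \<longlonglongrightarrow> 2 - 2 * (1 - 2 * real r * 0) ^ CARD('n)"
    by (intro tendsto_intros LIMSEQ_inverse_real_of_nat)
  moreover have "1 - 2 * real r * inverse (real (Suc N)) = (real N + 1 - 2 * real r) / (real N + 1)" for N
    by (simp add: field_simps)
  ultimately show "(\<lambda>N. 2 - 2 * ((real N + 1 - 2 * real r) / (real N + 1)) ^ CARD('n)) \<longlonglongrightarrow> 0"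
    by simp
qed

lemma norm_mean_box_shift_le:
  fixes H :: "int^'n \<Rightarrow> 'b::real_normed_vector"
  assumes "\<And>g. norm (H g) \<le> C"
  shows "norm (mean (int_box N) (\<lambda>g. H (w + g) - H g)) \<le> C * box_defect N w"
proof -
  let ?W = "(+) w ` int_box N"
  have "(\<Sum>g\<in>int_box N. H (w + g)) = sum H ?W"
    by (subst sum.reindex) (auto simp: inj_on_def)
  then have "(\<Sum>g\<in>int_box N. H (w + g) - H g) = sum H ?W - sum H (int_box N)"
    by (simp add: sum_subtractf)
  also have "\<dots> = sum H (?W - int_box N) - sum H (int_box N - ?W)"
    using sum.Int_Diff[of ?W H "int_box N"] sum.Int_Diff[of "int_box N" H ?W] by (simp add: Int_commute)
  also have "norm \<dots> \<le> of_nat (card (?W - int_box N)) * C + of_nat (card (int_box N - ?W)) * C"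
    by (intro order_trans[OF norm_triangle_ineq4] add_mono sum_norm_bound assms)
  also have "\<dots> = C * card (sym_diff (int_box N) ?W)"
    by (subst card_Un_disjoint) (auto simp: algebra_simps)
  finally show ?thesis
    by (simp add: mean_def box_defect_def divide_right_mono)
qed

section \<open>Orbit means and their products\<close>

locale finite_subgroup_GL_int =
  fixes F :: "(int^'n^'n) set"
  assumes subgroup_F: "subgroup F GL_int" and finite_F: "finite F"
begin

lemma one_in_F: "mat 1 \<in> F"
  using subgroup.one_closed[OF subgroup_F] by (simp add: GL_int_def)

lemma F_nonempty: "F \<noteq> {}" using one_in_F by blast

lemma mult_in_F: "\<alpha> \<in> F \<Longrightarrow> \<beta> \<in> F \<Longrightarrow> \<alpha> ** \<beta> \<in> F"
  using subgroup.m_closed[OF subgroup_F] by (simp add: GL_int_def)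

lemma inverse_in_F:
  assumes "\<gamma> \<in> F"
  obtains \<gamma>' where "\<gamma>' \<in> F" "\<gamma> ** \<gamma>' = mat 1" "\<gamma>' ** \<gamma> = mat 1"
proof
  interpret G: group "GL_int :: (int^'n^'n) monoid" by (rule group_GL_int)
  show "inv\<^bsub>GL_int\<^esub> \<gamma> \<in> F" by (rule subgroup.m_inv_closed[OF subgroup_F assms])
  have "\<gamma> \<in> carrier GL_int" using subgroup.mem_carrier[OF subgroup_F assms] .
  from G.r_inv[OF this] G.l_inv[OF this]
  show "\<gamma> ** (inv\<^bsub>GL_int\<^esub> \<gamma>) = mat 1" "(inv\<^bsub>GL_int\<^esub> \<gamma>) ** \<gamma> = mat 1"
    by (simp_all add: GL_int_def)
qed

lemma mean_F_translate:
  assumes "\<gamma> \<in> F"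
  shows "mean F (\<lambda>\<alpha>. h (\<gamma> ** \<alpha>)) = mean F h" "mean F (\<lambda>\<alpha>. h (\<alpha> ** \<gamma>)) = mean F h"
proof -
  obtain \<gamma>' where g: "\<gamma>' \<in> F" "\<gamma> ** \<gamma>' = mat 1" "\<gamma>' ** \<gamma> = mat 1"
    using inverse_in_F[OF assms] by blast
  have 1: "bij_betw (\<lambda>\<alpha>. \<gamma> ** \<alpha>) F F"
    by (rule bij_betwI[where g = "\<lambda>\<alpha>. \<gamma>' ** \<alpha>"]) (use g assms in \<open>auto simp: mult_in_F matrix_mul_assoc\<close>)
  have 2: "bij_betw (\<lambda>\<alpha>. \<alpha> ** \<gamma>) F F"
    by (rule bij_betwI[where g = "\<lambda>\<alpha>. \<alpha> ** \<gamma>'"])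
      (use g assms in \<open>auto simp: mult_in_F simp flip: matrix_mul_assoc\<close>)
  show "mean F (\<lambda>\<alpha>. h (\<gamma> ** \<alpha>)) = mean F h" "mean F (\<lambda>\<alpha>. h (\<alpha> ** \<gamma>)) = mean F h"
    unfolding mean_def using sum.reindex_bij_betw[OF 1, of h] sum.reindex_bij_betw[OF 2, of h] by simp_all
qed

lemma orbit_mean_eq_mean: "orbit_mean F v = mean F (\<lambda>\<alpha>. point_mass (\<alpha> *v v))"
  unfolding orbit_mean_def mean_def by (simp flip: scaleC_of_real)

lemma norm_orbit_mean_le: "norm (orbit_mean F v) \<le> 1"
  unfolding orbit_mean_eq_mean by (rule norm_mean_le_bound) (use finite_F F_nonempty in auto)

lemma orbit_mean_0: "orbit_mean F 0 = 1"
  unfolding orbit_mean_eq_mean by (simp add: mean_const finite_F F_nonempty one_l1_def)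

lemma orbit_mean_mult: "orbit_mean F v * orbit_mean F w = mean F (\<lambda>\<alpha>. orbit_mean F (\<alpha> *v v + w))"
proof -
  have "orbit_mean F v * orbit_mean F w =
      mean F (\<lambda>\<gamma>. mean F (\<lambda>\<beta>. point_mass (\<beta> *v v + \<gamma> *v w)))"
    unfolding orbit_mean_eq_mean mean_mult_mean point_mass_mult by (rule mean_swap)
  also have "\<dots> = mean F (\<lambda>\<gamma>. mean F (\<lambda>\<alpha>. point_mass (\<gamma> *v (\<alpha> *v v + w))))"
  proof (rule mean_cong)
    fix \<gamma> assume "\<gamma> \<in> F"
    from mean_F_translate(1)[OF this, of "\<lambda>\<beta>. point_mass (\<beta> *v v + \<gamma> *v w)"]
    show "mean F (\<lambda>\<beta>. point_mass (\<beta> *v v + \<gamma> *v w)) = mean F (\<lambda>\<alpha>. point_mass (\<gamma> *v (\<alpha> *v v + w)))"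
      by (simp add: matrix_vector_mul_assoc matrix_vector_right_distrib)
  qed
  also have "\<dots> = mean F (\<lambda>\<alpha>. orbit_mean F (\<alpha> *v v + w))"
    unfolding orbit_mean_eq_mean by (rule mean_swap)
  finally show ?thesis .
qed

text \<open>
  As \<open>N\<close> grows, these elements approach an invariant mean on the subgroup of all \<open>\<alpha> h - h\<close>. The
  additional average over \<open>\<gamma>\<close> is what products of orbit means produce; it makes up for the boxes not
  being invariant under \<open>F\<close>.
\<close>

definition coboundary_mean :: "int^'n^'n \<Rightarrow> nat \<Rightarrow> (int^'n) l1" where
  "coboundary_mean \<alpha> N =
     mean F (\<lambda>\<gamma>. mean (int_box N) (\<lambda>g. point_mass (\<alpha> *v (\<gamma> *v g) - \<gamma> *v g)))"

lemma norm_coboundary_mean_le: "norm (coboundary_mean \<alpha> N) \<le> 1"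
  unfolding coboundary_mean_def
  by (intro norm_mean_le_bound) (use finite_F F_nonempty in auto)

lemma coboundary_mean_1: "coboundary_mean (mat 1) N = 1"
  unfolding coboundary_mean_def by (simp add: mean_const finite_F F_nonempty one_l1_def)

text \<open>
  Expanding both orbit means gives point masses at \<open>\<beta> g - \<gamma> g\<close>; the substitution
  \<open>\<beta> = \<alpha> \<gamma>\<close> turns them into \<open>\<alpha> (\<gamma> g) - \<gamma> g\<close>.
\<close>

lemma mean_orbit_mean_mult:
  "mean (int_box N) (\<lambda>g. orbit_mean F (- g) * orbit_mean F g) = mean F (\<lambda>\<alpha>. coboundary_mean \<alpha> N)"
proof -
  have "orbit_mean F (- g) * orbit_mean F g =
      mean F (\<lambda>\<alpha>. mean F (\<lambda>\<gamma>. point_mass (\<alpha> *v (\<gamma> *v g) - \<gamma> *v g)))" for g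
  proof -
    have neg: "\<gamma> *v (- g) = - (\<gamma> *v g)" for \<gamma> :: "int^'n^'n"
      using matrix_vector_mult_diff_distrib[of \<gamma> 0 g] by simp
    have "orbit_mean F (- g) * orbit_mean F g =
        mean F (\<lambda>\<gamma>. mean F (\<lambda>\<beta>. point_mass (\<beta> *v g - \<gamma> *v g)))"
      unfolding orbit_mean_eq_mean mean_mult_mean point_mass_mult
      by (simp add: neg add.commute[of "- _"])
    also have "\<dots> = mean F (\<lambda>\<gamma>. mean F (\<lambda>\<alpha>. point_mass (\<alpha> *v (\<gamma> *v g) - \<gamma> *v g)))"
    proof (rule mean_cong)
      fix \<gamma> assume "\<gamma> \<in> F"
      from mean_F_translate(2)[OF this, of "\<lambda>\<beta>. point_mass (\<beta> *v g - \<gamma> *v g)"]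
      show "mean F (\<lambda>\<beta>. point_mass (\<beta> *v g - \<gamma> *v g)) =
          mean F (\<lambda>\<alpha>. point_mass (\<alpha> *v (\<gamma> *v g) - \<gamma> *v g))"
        by (simp add: matrix_vector_mul_assoc)
    qed
    also have "\<dots> = mean F (\<lambda>\<alpha>. mean F (\<lambda>\<gamma>. point_mass (\<alpha> *v (\<gamma> *v g) - \<gamma> *v g)))"
      by (rule mean_swap)
    finally show ?thesis .
  qed
  then show ?thesis
    unfolding coboundary_mean_def mean_swap[of "int_box N" F] by (simp add: mean_swap[of "int_box N" F])
qed

text \<open>
  Multiplication by the point mass at \<open>\<alpha> h - h\<close> translates the box that belongs to \<open>\<gamma>\<close> by the inverse
  image of \<open>h\<close> under \<open>\<gamma>\<close>, which is \<open>i \<gamma> h\<close> in the proof.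
\<close>

lemma coboundary_mean_translate:
  assumes "\<alpha> \<in> F"
  shows "(\<lambda>N. coboundary_mean \<alpha> N * point_mass (\<alpha> *v h - h) - coboundary_mean \<alpha> N) \<longlonglongrightarrow> 0"
proof -
  have "\<exists>\<gamma>'. \<gamma> \<in> F \<longrightarrow> \<gamma> *v (\<gamma>' *v h) = h" for \<gamma>
    using inverse_in_F[of \<gamma>] by (metis matrix_vector_mul_assoc matrix_vector_mul_lid)
  then obtain i where i: "\<And>\<gamma>. \<gamma> \<in> F \<Longrightarrow> \<gamma> *v (i \<gamma> *v h) = h" by metis
  have "norm (coboundary_mean \<alpha> N * point_mass (\<alpha> *v h - h) - coboundary_mean \<alpha> N) \<le>
      mean F (\<lambda>\<gamma>. box_defect N (i \<gamma> *v h))" for N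
  proof -
    define H where "H \<gamma> g = point_mass (\<alpha> *v (\<gamma> *v g) - \<gamma> *v g)" for \<gamma> :: "int^'n^'n" and g
    have "H \<gamma> g * point_mass (\<alpha> *v h - h) = H \<gamma> (i \<gamma> *v h + g)" if "\<gamma> \<in> F" for \<gamma> g
      using i[OF that] by (simp add: H_def point_mass_mult matrix_vector_right_distrib algebra_simps)
    then have "coboundary_mean \<alpha> N * point_mass (\<alpha> *v h - h) - coboundary_mean \<alpha> N =
        mean F (\<lambda>\<gamma>. mean (int_box N) (\<lambda>g. H \<gamma> (i \<gamma> *v h + g) - H \<gamma> g))"
      unfolding coboundary_mean_def mean_mult_right[symmetric] mean_diff[symmetric] H_def[symmetric]
      by (simp cong: mean_cong)
    also have "norm \<dots> \<le> mean F (\<lambda>\<gamma>. 1 * box_defect N (i \<gamma> *v h))"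
      by (intro order_trans[OF norm_mean_le] mean_mono norm_mean_box_shift_le) (simp add: H_def)
    finally show ?thesis by simp
  qed
  then have "\<forall>\<^sub>F N in sequentially. norm (coboundary_mean \<alpha> N * point_mass (\<alpha> *v h - h) - coboundary_mean \<alpha> N)
      \<le> mean F (\<lambda>\<gamma>. box_defect N (i \<gamma> *v h))" by simp
  moreover have "(\<lambda>N. mean F (\<lambda>\<gamma>. box_defect N (i \<gamma> *v h))) \<longlonglongrightarrow> 0"
    by (intro tendsto_mean_0 box_defect_tendsto_0)
  ultimately show ?thesis by (rule Lim_null_comparison)
qed

text \<open>
  The factor at the fixed scale \<open>M\<close> is a mean of point masses at elements of the form \<open>\<alpha> h - h\<close>.
\<close>

lemma coboundary_mean_absorb:
  assumes "\<alpha> \<in> F"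
  shows "(\<lambda>N. coboundary_mean \<alpha> N * coboundary_mean \<alpha> M - coboundary_mean \<alpha> N) \<longlonglongrightarrow> 0"
proof -
  have "coboundary_mean \<alpha> N * coboundary_mean \<alpha> M - coboundary_mean \<alpha> N =
      mean F (\<lambda>\<gamma>. mean (int_box M) (\<lambda>g.
        coboundary_mean \<alpha> N * point_mass (\<alpha> *v (\<gamma> *v g) - \<gamma> *v g) - coboundary_mean \<alpha> N))" for N
    unfolding mean_diff mean_mult_left coboundary_mean_def[of \<alpha> M]
    by (simp add: mean_const finite_F F_nonempty)
  moreover have "(\<lambda>N. mean F (\<lambda>\<gamma>. mean (int_box M) (\<lambda>g.
        coboundary_mean \<alpha> N * point_mass (\<alpha> *v (\<gamma> *v g) - \<gamma> *v g) - coboundary_mean \<alpha> N))) \<longlonglongrightarrow> 0"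
    by (intro tendsto_mean_0 coboundary_mean_translate assms)
  ultimately show ?thesis by simp
qed

end

section \<open>The approximate diagonal\<close>

lemma bounded_bilinear_form_on_mean:
  assumes "csubalgebra A" "bounded_bilinear_form_on A T" "b \<in> A" "\<And>x. x \<in> X \<Longrightarrow> f x \<in> A"
  shows "T (mean X f) b = mean X (\<lambda>x. T (f x) b)" "T b (mean X f) = mean X (\<lambda>x. T b (f x))"
proof -
  have T: "\<And>a a' b. a \<in> A \<Longrightarrow> a' \<in> A \<Longrightarrow> b \<in> A \<Longrightarrow> T (a + a') b = T a b + T a' b \<and> T b (a + a') = T b a + T b a'"
    "\<And>a b r. a \<in> A \<Longrightarrow> b \<in> A \<Longrightarrow> T (r *\<^sub>R a) b = r *\<^sub>R T a b \<and> T a (r *\<^sub>R b) = r *\<^sub>R T a b"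
    using assms(2) unfolding bounded_bilinear_form_on_def by (simp_all add: scaleR_conv_of_real flip: scaleC_of_real)
  have "sum f X \<in> A" using assms by (intro csubalgebra_closure)
  then show "T (mean X f) b = mean X (\<lambda>x. T (f x) b)" "T b (mean X f) = mean X (\<lambda>x. T b (f x))"
    unfolding mean_def
    using T assms sum_additive_on[OF assms(1), of "\<lambda>a. T a b" X f] sum_additive_on[OF assms(1), of "\<lambda>a. T b a" X f]
    by simp_all
qed

context finite_subgroup_GL_int
begin

text \<open>
  The product starts at \<open>j = 1\<close> and not at \<open>j = 0\<close> because the identity matrix contributes the
  idempotent \<open>1\<close>, which every \<open>y\<close> absorbs: the set \<open>T\<close> of \<open>absorbing_product_tendsto_0\<close> starts as
  \<open>{mat 1}\<close>, with \<open>y = 1\<close>.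
\<close>

lemma coboundary_mean_scales:
  obtains N where "\<And>j t. j \<le> card F \<Longrightarrow> t \<le> N j t"
    and "(\<lambda>t. \<Prod>j = 1..card F. of_nat j - (\<Sum>\<alpha>\<in>F. coboundary_mean \<alpha> (N j t))) \<longlonglongrightarrow> 0"
proof -
  define z where "z n m = (\<Sum>\<alpha>\<in>F. norm (coboundary_mean \<alpha> n * coboundary_mean \<alpha> m - coboundary_mean \<alpha> n))" for n m
  have "(\<lambda>n. z n m) \<longlonglongrightarrow> 0" for m
    unfolding z_def by (intro tendsto_null_sum tendsto_norm_zero coboundary_mean_absorb)
  then obtain N where N: "\<And>j t. j \<le> card F \<Longrightarrow> t \<le> N j t"
    and z: "\<And>i j. i < j \<Longrightarrow> j \<le> card F \<Longrightarrow> (\<lambda>t. z (N i t) (N j t)) \<longlonglongrightarrow> 0"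
    using scale_sequence[of z "card F"] by blast
  have absorb: "(\<lambda>t. coboundary_mean \<alpha> (N i t) * coboundary_mean \<alpha> (N j t) - coboundary_mean \<alpha> (N i t)) \<longlonglongrightarrow> 0"
    if "\<alpha> \<in> F" "i < j" "j \<le> card F" for \<alpha> i j
  proof (rule Lim_null_comparison[OF _ z[OF that(2,3)]])
    show "\<forall>\<^sub>F t in sequentially. norm (coboundary_mean \<alpha> (N i t) * coboundary_mean \<alpha> (N j t) -
        coboundary_mean \<alpha> (N i t)) \<le> z (N i t) (N j t)"
      unfolding z_def using that(1) finite_F by (intro always_eventually allI member_le_sum) auto
  qed
  have "(\<lambda>t. 1 * (\<Prod>j = card {mat 1 :: int^'n^'n}..card F. of_nat j - (\<Sum>\<alpha>\<in>F. coboundary_mean \<alpha> (N j t)))) \<longlonglongrightarrow> 0"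
    by (rule absorbing_product_tendsto_0[where Y = 1])
      (auto simp: finite_F norm_coboundary_mean_le one_in_F coboundary_mean_1 intro: absorb)
  then show thesis using N by (intro that[of N]) simp_all
qed

text \<open>
  The approximate diagonal is the sum over the scales \<open>N 1 t, \<dots>, N k t\<close> of the means of
  \<open>\<beta> i t * c (- g) \<otimes> c g\<close> over the box at that scale, where \<open>c = orbit_mean F\<close> and the scale \<open>N (i + 1) t\<close>
  belongs to \<open>\<beta> i t\<close>. The element \<open>x j t\<close> is \<open>k / (j + 1)\<close> times the product \<open>u\<close> of the means at
  scale \<open>N (j + 1) t\<close>, and \<open>\<beta> i t\<close> is chosen such that \<open>\<beta> i t * u\<close> is the \<open>i\<close>-th term in the
  telescoping expansion of \<open>1 - (\<Prod>j<k. 1 - x j t)\<close>.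
\<close>

lemma amenable_l1_quotient: "amenable TYPE('x::{complex_normed_vector, banach}) (l1_quotient F)"
proof -
  define A where "A = l1_quotient F"
  have subalg: "csubalgebra A"
    using closed_csubalgebra_hull by (auto simp: A_def l1_quotient_def closed_csubalgebra_def)
  note sub = csubalgebra_closure[OF subalg]
  have cA: "orbit_mean F v \<in> A" for v unfolding A_def l1_quotient_def by (rule hull_inc) simp
  have oneA: "1 \<in> A" using cA[of 0] by (simp add: orbit_mean_0)
  define k where "k = card F"
  have k: "k > 0" using finite_F F_nonempty by (simp add: k_def card_gt_0_iff)
  obtain N where N: "\<And>j t. j \<le> k \<Longrightarrow> t \<le> N j t"
    and N0: "(\<lambda>t. \<Prod>j = 1..k. of_nat j - (\<Sum>\<alpha>\<in>F. coboundary_mean \<alpha> (N j t))) \<longlonglongrightarrow> 0"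
    unfolding k_def by (rule coboundary_mean_scales) blast
  define u where "u M = mean F (\<lambda>\<alpha>. coboundary_mean \<alpha> M)" for M
  have u_eq: "mean (int_box M) (\<lambda>g. orbit_mean F (- g) * orbit_mean F g) = u M" for M
    unfolding u_def by (rule mean_orbit_mean_mult)
  have uA: "u M \<in> A" for M
    unfolding u_eq[symmetric] mean_def by (intro sub(5) sub(8) sub(3) cA)
  have norm_u: "norm (u M) \<le> 1" for M
    unfolding u_def by (intro norm_mean_le_bound norm_coboundary_mean_le finite_F F_nonempty)
  define x where "x j t = (real k / real (Suc j)) *\<^sub>R u (N (Suc j) t)" for j t
  have norm_x: "norm (x j t) \<le> real k" for j t
  proof -
    have "norm (x j t) \<le> (real k / real (Suc j)) * 1"
      unfolding x_def norm_scaleR by (intro mult_mono norm_u) auto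
    also have "\<dots> \<le> real k" by (simp add: divide_le_eq mult_le_cancel_left1)
    finally show ?thesis .
  qed
  have remainder: "(\<lambda>t. \<Prod>j<k. 1 - x j t) \<longlonglongrightarrow> 0"
  proof -
    have "(\<Prod>j = 1..k. of_nat j - (\<Sum>\<alpha>\<in>F. coboundary_mean \<alpha> (N j t))) =
        of_nat (fact k) * (\<Prod>j<k. 1 - x j t)" for t
    proof -
      have "of_nat (Suc j) - (\<Sum>\<alpha>\<in>F. coboundary_mean \<alpha> (N (Suc j) t)) = of_nat (Suc j) * (1 - x j t)" for j
      proof -
        have "(\<Sum>\<alpha>\<in>F. coboundary_mean \<alpha> (N (Suc j) t)) = real k *\<^sub>R u (N (Suc j) t)"
          using k by (simp add: u_def mean_def k_def)
        moreover have nat_mult: "of_nat (Suc j) * y = real (Suc j) *\<^sub>R y" for y :: "(int^'n) l1"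
          by (simp add: scaleR_conv_of_real del: of_nat_Suc)
        moreover have "of_nat (Suc j) * x j t = real k *\<^sub>R u (N (Suc j) t)"
          unfolding x_def nat_mult scaleR_scaleR by simp
        ultimately show ?thesis by (simp add: right_diff_distrib)
      qed
      then have "(\<Prod>j<k. of_nat (Suc j) - (\<Sum>\<alpha>\<in>F. coboundary_mean \<alpha> (N (Suc j) t))) =
          of_nat (\<Prod>j<k. Suc j) * (\<Prod>j<k. 1 - x j t)"
        by (simp add: prod.distrib del: of_nat_Suc)
      moreover have "(\<Prod>j<k. Suc j) = fact k"
        by (simp add: fact_prod_Suc lessThan_atLeast0)
      ultimately show ?thesis
        by (simp add: prod.atLeast1_atMost_eq del: of_nat_Suc)
    qed
    with N0 have "(\<lambda>t. of_nat (fact k) * (\<Prod>j<k. 1 - x j t)) \<longlonglongrightarrow> 0" by simp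
    then have "(\<lambda>t. of_real (inverse (fact k)) * (of_nat (fact k) * (\<Prod>j<k. 1 - x j t))) \<longlonglongrightarrow> of_real (inverse (fact k)) * 0"
      by (intro tendsto_intros)
    moreover have "of_real (inverse (fact k)) * (of_nat (fact k) * y) = y" for y :: "(int^'n) l1"
    proof -
      have "of_real (inverse (fact k)) * (of_nat (fact k) :: (int^'n) l1) = of_real (inverse (fact k) * fact k)"
        unfolding of_real_mult by simp
      then show ?thesis by (simp add: mult.assoc[symmetric])
    qed
    ultimately show ?thesis by simp
  qed
  define \<beta> where "\<beta> i t = (real k / real (Suc i)) *\<^sub>R (\<Prod>j<i. 1 - x j t)" for i t
  have \<beta>A: "\<beta> i t \<in> A" for i t
  proof -
    have "(\<Prod>j<i. 1 - x j t) \<in> A"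
      by (induction i) (auto simp: x_def intro!: oneA sub uA)
    then show ?thesis unfolding \<beta>_def by (rule sub(5))
  qed
  define C where "C i = real k * (1 + real k) ^ i" for i
  have norm_\<beta>: "norm (\<beta> i t) \<le> C i" for i t
  proof -
    have "norm (\<Prod>j<i. 1 - x j t) \<le> (\<Prod>j<i. 1 + real k)"
      by (intro order_trans[OF norm_prod_le] prod_mono conjI norm_ge_zero
          order_trans[OF norm_triangle_ineq4] add_mono norm_x) simp_all
    moreover have "real k / real (Suc i) \<le> real k" by (simp add: divide_le_eq mult_le_cancel_left1)
    ultimately show ?thesis
      unfolding \<beta>_def C_def norm_scaleR by (intro mult_mono) auto
  qed
  have C0: "C i \<ge> 0" for i by (simp add: C_def)
  define J where "J t = (SIGMA i:{..<k}. (int_box (N (Suc i) t) :: (int^'n) set))" for t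
  define a where "a t = (\<lambda>(i, g). (1 / card (int_box (N (Suc i) t) :: (int^'n) set)) *\<^sub>R
      (\<beta> i t * orbit_mean F (- g)))" for t
  define b where "b t = (\<lambda>(i :: nat, g). orbit_mean F g)" for t :: nat
  have sum_J: "(\<Sum>p\<in>J t. h p) = (\<Sum>i<k. \<Sum>g\<in>int_box (N (Suc i) t). h (i, g))"
    for h :: "nat \<times> (int^'n) \<Rightarrow> 'b::comm_monoid_add" and t
    unfolding J_def by (subst sum.Sigma) auto
  have "amenable TYPE('x) A"
  proof (rule amenable_if_weak_approximate_diagonal[where S = "range (orbit_mean F)" and e = 1
        and J = J and a = a and b = b and C = "\<Sum>i<k. C i"])
    show "A = closed_csubalgebra hull range (orbit_mean F)" by (simp add: A_def l1_quotient_def)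
    show "1 \<in> A" by (rule oneA)
    show "a t p \<in> A" "b t p \<in> A" for t p
      by (cases p; simp add: a_def b_def sub \<beta>A cA)+
    show "(\<Sum>p\<in>J t. norm (a t p) * norm (b t p)) \<le> (\<Sum>i<k. C i)" for t
      unfolding sum_J
    proof (rule sum_mono)
      fix i
      let ?B = "int_box (N (Suc i) t) :: (int^'n) set"
      have "norm (a t (i, g)) * norm (b t (i, g)) \<le> (1 / card ?B) * C i" for g
      proof -
        have "norm (\<beta> i t * orbit_mean F (- g)) * norm (orbit_mean F g) \<le> (C i * 1) * 1"
          by (intro mult_mono order_trans[OF norm_mult_ineq] norm_\<beta> norm_orbit_mean_le) (auto simp: C0)
        then have "(1 / card ?B) * (norm (\<beta> i t * orbit_mean F (- g)) * norm (orbit_mean F g)) \<le> (1 / card ?B) * (C i)"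
          by (intro mult_left_mono) auto
        then show ?thesis by (simp add: a_def b_def)
      qed
      then have "(\<Sum>g\<in>?B. norm (a t (i, g)) * norm (b t (i, g))) \<le> (\<Sum>g\<in>?B. (1 / card ?B) * C i)"
        by (rule sum_mono)
      also have "\<dots> = C i" by (simp add: card_int_box)
      finally show "(\<Sum>g\<in>?B. norm (a t (i, g)) * norm (b t (i, g))) \<le> C i" .
    qed
    have "(\<Sum>p\<in>J t. a t p * b t p) = 1 - (\<Prod>j<k. 1 - x j t)" for t
    proof -
      have "(\<Sum>g\<in>int_box (N (Suc i) t). a t (i, g) * b t (i, g)) = (\<Prod>j<i. 1 - x j t) * x i t" for i
      proof -
        have "(\<Sum>g\<in>int_box (N (Suc i) t). a t (i, g) * b t (i, g)) =
            mean (int_box (N (Suc i) t)) (\<lambda>g. \<beta> i t * (orbit_mean F (- g) * orbit_mean F g))"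
          by (simp add: mean_def a_def b_def scaleR_sum_right mult.assoc)
        also have "\<dots> = \<beta> i t * u (N (Suc i) t)" unfolding mean_mult_left u_eq ..
        finally show ?thesis by (simp add: \<beta>_def x_def)
      qed
      then show ?thesis unfolding sum_J one_minus_prod_one_minus by simp
    qed
    then show "(\<lambda>t. \<Sum>p\<in>J t. a t p * b t p) \<longlonglongrightarrow> 1"
      using tendsto_diff[OF tendsto_const[of 1] remainder] by simp
    show "(\<lambda>t. \<Sum>p\<in>J t. T (s * a t p) (b t p) - T (a t p) (b t p * s)) \<longlonglongrightarrow> 0"
      if T: "bounded_bilinear_form_on A T" and s: "s \<in> range (orbit_mean F)" for T s
    proof -
      obtain v where v: "s = orbit_mean F v" using s by blast
      obtain K0 where K0: "\<And>a b. a \<in> A \<Longrightarrow> b \<in> A \<Longrightarrow> cmod (T a b) \<le> K0 * norm a * norm b"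
        using T unfolding bounded_bilinear_form_on_def by blast
      define K where "K = \<bar>K0\<bar>"
      have K: "cmod (T a b) \<le> K * norm a * norm b" if "a \<in> A" "b \<in> A" for a b
        by (rule order_trans[OF K0[OF that]]) (auto simp: K_def intro!: mult_right_mono)
      have T_scale: "T (r *\<^sub>R a) b = r *\<^sub>R T a b" if "a \<in> A" "b \<in> A" for a b r
        using T that unfolding bounded_bilinear_form_on_def
        by (simp add: scaleR_conv_of_real[where 'a = complex] flip: scaleC_of_real)
      \<comment> \<open>With \<open>w = \<alpha> v\<close>, moving \<open>s = c v\<close> from the left factor to the right one replaces \<open>H i t w g\<close>
         by \<open>H i t w (w + g)\<close>, a translation that is negligible on average over a large box.\<close>
      define H where "H i t w g = T (\<beta> i t * orbit_mean F (w - g)) (orbit_mean F g)" for i t w g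
      have norm_H: "norm (H i t w g) \<le> K * C i" for i t w g
      proof -
        have "norm (\<beta> i t * orbit_mean F (w - g)) * norm (orbit_mean F g) \<le> (C i * 1) * 1"
          by (intro mult_mono order_trans[OF norm_mult_ineq] norm_\<beta> norm_orbit_mean_le) (auto simp: C0)
        then have "K * (norm (\<beta> i t * orbit_mean F (w - g)) * norm (orbit_mean F g)) \<le> K * C i"
          by (intro mult_left_mono) (auto simp: K_def)
        then show ?thesis
          unfolding H_def using K[of "\<beta> i t * orbit_mean F (w - g)" "orbit_mean F g"]
          by (simp add: sub \<beta>A cA mult.assoc)
      qed
      have summand: "T (s * a t (i, g)) (b t (i, g)) - T (a t (i, g)) (b t (i, g) * s) =
          - ((1 / card (int_box (N (Suc i) t) :: (int^'n) set)) *\<^sub>R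
          mean F (\<lambda>\<alpha>. H i t (\<alpha> *v v) (\<alpha> *v v + g) - H i t (\<alpha> *v v) g))" for t i g
      proof -
        let ?r = "1 / card (int_box (N (Suc i) t) :: (int^'n) set)"
        have 1: "s * a t (i, g) = ?r *\<^sub>R mean F (\<lambda>\<alpha>. \<beta> i t * orbit_mean F (\<alpha> *v v - g))"
          unfolding mean_mult_left using orbit_mean_mult[of v "- g"] by (simp add: a_def v mult.left_commute[of "orbit_mean F v"])
        have 2: "b t (i, g) * s = mean F (\<lambda>\<alpha>. orbit_mean F (\<alpha> *v v + g))"
          unfolding b_def v using orbit_mean_mult[of v g] by (simp add: mult.commute)
        have "mean F (\<lambda>\<alpha>. \<beta> i t * orbit_mean F (\<alpha> *v v - g)) \<in> A"
          unfolding mean_def by (intro sub(5) sub(8) sub(3) \<beta>A cA)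
        then have 3: "T (s * a t (i, g)) (b t (i, g)) = ?r *\<^sub>R mean F (\<lambda>\<alpha>. H i t (\<alpha> *v v) g)"
          unfolding 1 H_def b_def
          by (simp add: T_scale cA bounded_bilinear_form_on_mean[OF subalg T] sub \<beta>A)
        have "mean F (\<lambda>\<alpha>. orbit_mean F (\<alpha> *v v + g)) \<in> A"
          unfolding mean_def by (intro sub(5) sub(8) cA)
        then have 4: "T (a t (i, g)) (b t (i, g) * s) = ?r *\<^sub>R mean F (\<lambda>\<alpha>. H i t (\<alpha> *v v) (\<alpha> *v v + g))"
          unfolding 2 H_def a_def
          by (simp add: T_scale cA bounded_bilinear_form_on_mean[OF subalg T] sub \<beta>A mean_scaleR)
        show ?thesis unfolding 3 4 mean_diff by (simp add: scaleR_diff_right)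
      qed
      have sum_summand: "(\<Sum>g\<in>int_box (N (Suc i) t). T (s * a t (i, g)) (b t (i, g)) - T (a t (i, g)) (b t (i, g) * s)) =
          - mean F (\<lambda>\<alpha>. mean (int_box (N (Suc i) t)) (\<lambda>g. H i t (\<alpha> *v v) (\<alpha> *v v + g) - H i t (\<alpha> *v v) g))" for i t
        unfolding summand mean_swap[of F] unfolding mean_def[of "int_box _"] by (simp add: scaleR_sum_right sum_negf)
      have "(\<lambda>t. \<Sum>g\<in>int_box (N (Suc i) t). T (s * a t (i, g)) (b t (i, g)) - T (a t (i, g)) (b t (i, g) * s)) \<longlonglongrightarrow> 0"
        if i: "i < k" for i
        unfolding sum_summand
      proof (rule Lim_null_comparison)
        show "\<forall>\<^sub>F t in sequentially. norm (- mean F (\<lambda>\<alpha>. mean (int_box (N (Suc i) t))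
            (\<lambda>g. H i t (\<alpha> *v v) (\<alpha> *v v + g) - H i t (\<alpha> *v v) g))) \<le>
            mean F (\<lambda>\<alpha>. K * C i * box_defect (N (Suc i) t) (\<alpha> *v v))"
          unfolding norm_minus_cancel
          by (intro always_eventually allI order_trans[OF norm_mean_le] mean_mono norm_mean_box_shift_le norm_H)
        have "filterlim (N (Suc i)) sequentially sequentially"
          using N[of "Suc i"] i by (intro filterlim_at_top_mono[OF filterlim_ident] always_eventually) auto
        then have "(\<lambda>t. box_defect (N (Suc i) t) w) \<longlonglongrightarrow> 0" for w :: "int^'n"
          by (rule filterlim_compose[OF box_defect_tendsto_0])
        then show "(\<lambda>t. mean F (\<lambda>\<alpha>. K * C i * box_defect (N (Suc i) t) (\<alpha> *v v))) \<longlonglongrightarrow> 0"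
          by (intro tendsto_mean_0 tendsto_mult_right_zero)
      qed
      then show ?thesis unfolding sum_J by (intro tendsto_null_sum) auto
    qed
  qed auto
  then show ?thesis unfolding A_def .
qed

end

theorem mainTheorem10:
  fixes F :: "(int^'n^'n) set"
  assumes "subgroup F GL_int"
    and "finite F"
  shows "amenable TYPE('x::{complex_normed_vector, banach}) (l1_quotient F)"
proof -
  interpret finite_subgroup_GL_int F by (rule finite_subgroup_GL_int.intro) (fact assms)+
  show ?thesis by (rule amenable_l1_quotient)
qed

end
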